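(* Let $D=(d_1,\dots,d_n)\in\mathcal D^n$ be a dataset and let $f:\mathbb R^p\times\mathcal D\to\mathbb R$ be convex and continuously differentiable in its first argument, with $\|\nabla f(x,d)\|_2\le C$ for all $x\in\mathbb R^p$ and $d\in\mathcal D$, for some constant $C>0$. Fix $\lambda>0$, $\rho>0$, a mini-batch size $m\in\{1,\dots,n\}$, a number of iterations $T$, learning rates $\eta^0,\dots,\eta^{T-1}>0$, a noise level $\sigma>0$, and data-independent initial vectors $x^0,z^0,y^0\in\mathbb R^p$. Consider the randomized algorithm (ssADMM) which, for $k=0,1,\dots,T-1$: (i) samples a mini-batch $B_k$ of $m$ records from $D$ uniformly at random without replacement; (ii) computes $g_k=\frac1m\sum_{d\in B_k}\nabla f(x^k,d)$ and $\tilde g_k=g_k+\gamma_k$ with $\gamma_k\sim\mathcal N(0,\sigma^2 I_p)$ drawn independently; (iii) sets $x^{k+1}=\frac{1}{\rho+1/\eta^k}\left(-\tilde g_k-y^k+\rho z^k+x^k/\eta^k\right)$; (iv) sets $z^{k+1}=\mathcal S_{\lambda/\rho}(x^{k+1}+y^k/\rho)$, where $\mathcal S_t$ is the coordinatewise soft-thresholding operator $\mathcal S_t(w)_i=w_i-t$ if $w_i>t$, $w_i+t$ if $w_i<-t$, and $0$ otherwise; (v) sets $y^{k+1}=y^k+\rho(x^{k+1}-z^{k+1})$; and finally outputs $x^T$. Let $q=m/n$, and for integers $j\ge 2$ let $\epsilon(j)=\frac{j\,(2C/m)^2}{2\sigma^2}$. For integer $\alpha\ge2$ define $$\epsilon'(\alpha)=\frac{1}{\alpha-1}\log\Big(1+q^2\binom{\alpha}{2}\min\{4(e^{\epsilon(2)}-1),\,2e^{\epsilon(2)}\}+\sum_{j=3}^{\alpha}q^j\binom{\alpha}{j}2e^{(j-1)\epsilon(j)}\Big).$$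 Then for every integer $\alpha\ge 2$ this algorithm satisfies $(\alpha,\,T\epsilon'(\alpha))$-Rényi differential privacy.
   Context: Two datasets $D,D'\in\mathcal D^n$ are neighboring ($D\sim D'$) if $D'$ is obtained from $D$ by replacing one record with another element of $\mathcal D$. For $\alpha\in(1,\infty)$, the Rényi divergence of distributions $P,Q$ is $D_\alpha(P\|Q)=\frac{1}{\alpha-1}\log\mathbb E_{x\sim Q}\big[(P(x)/Q(x))^\alpha\big]$. A randomized mechanism $\mathcal M$ satisfies $(\alpha,\epsilon)$-Rényi differential privacy (RDP) if $D_\alpha(\mathcal M(D)\|\mathcal M(D'))\le\epsilon$ for every pair of neighboring datasets $D\sim D'$. *)

theory Defs
  imports "HOL-Probability.Probability"
begin

definition neighboring :: "nat \<Rightarrow> 'd list \<Rightarrow> 'd list \<Rightarrow> bool" where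
  "neighboring n D D' \<longleftrightarrow> length D = n \<and> length D' = n \<and>
     (\<exists>i<n. \<forall>j<n. j \<noteq> i \<longrightarrow> D ! j = D' ! j)"

definition renyi_divergence :: "real \<Rightarrow> 'a measure \<Rightarrow> 'a measure \<Rightarrow> ereal" where
  "renyi_divergence \<alpha> P Q =
    (if sets P = sets Q \<and> absolutely_continuous Q P then
       (let I = (\<integral>\<^sup>+ x. ennreal ((enn2real (RN_deriv Q P x)) powr \<alpha>) \<partial>Q)
        in if I = \<infinity> then \<infinity> else ereal (ln (enn2real I) / (\<alpha> - 1)))
     else \<infinity>)"

definition renyi_dp :: "nat \<Rightarrow> ('d list \<Rightarrow> 'b measure) \<Rightarrow> real \<Rightarrow> real \<Rightarrow> bool" where
  "renyi_dp n M \<alpha> \<epsilon> \<longleftrightarrow>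
     (\<forall>D D'. neighboring n D D' \<longrightarrow> renyi_divergence \<alpha> (M D) (M D') \<le> ereal \<epsilon>)"

definition soft_threshold :: "real \<Rightarrow> real ^ 'p \<Rightarrow> real ^ 'p" where
  "soft_threshold t w = (\<chi> i. if w $ i > t then w $ i - t
                               else if w $ i < - t then w $ i + t else 0)"

definition gaussian_vec :: "real \<Rightarrow> (real ^ 'p) measure" where
  "gaussian_vec \<sigma> = density lborel (\<lambda>g. ennreal (\<Prod>i\<in>UNIV. normal_density 0 \<sigma> (g $ i)))"

definition batches :: "nat \<Rightarrow> nat \<Rightarrow> nat set set" where
  "batches n m = {B. B \<subseteq> {..<n} \<and> card B = m}"

definition ssadmm_step ::
  "'d list \<Rightarrow> (real ^ 'p \<Rightarrow> 'd \<Rightarrow> real ^ 'p) \<Rightarrow> nat \<Rightarrow> real \<Rightarrow> real \<Rightarrow> real \<Rightarrow>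
   nat set \<Rightarrow> real ^ 'p \<Rightarrow> ((real ^ 'p) \<times> (real ^ 'p) \<times> (real ^ 'p)) \<Rightarrow>
   ((real ^ 'p) \<times> (real ^ 'p) \<times> (real ^ 'p))" where
  "ssadmm_step D grad m lam \<rho> \<eta>k B \<gamma> s =
    (case s of (x, z, y) \<Rightarrow>
      (let g = (1 / real m) *\<^sub>R (\<Sum>i\<in>B. grad x (D ! i));
           gt = g + \<gamma>;
           x' = (1 / (\<rho> + 1 / \<eta>k)) *\<^sub>R (- gt - y + \<rho> *\<^sub>R z + (1 / \<eta>k) *\<^sub>R x);
           z' = soft_threshold (lam / \<rho>) (x' + (1 / \<rho>) *\<^sub>R y);
           y' = y + \<rho> *\<^sub>R (x' - z')
       in (x', z', y')))"

fun ssadmm_iter ::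
  "'d list \<Rightarrow> (real ^ 'p \<Rightarrow> 'd \<Rightarrow> real ^ 'p) \<Rightarrow> nat \<Rightarrow> real \<Rightarrow> real \<Rightarrow> (nat \<Rightarrow> real) \<Rightarrow>
   ((real ^ 'p) \<times> (real ^ 'p) \<times> (real ^ 'p)) \<Rightarrow> (nat \<Rightarrow> nat set \<times> (real ^ 'p)) \<Rightarrow> nat \<Rightarrow>
   ((real ^ 'p) \<times> (real ^ 'p) \<times> (real ^ 'p))" where
  "ssadmm_iter D grad m lam \<rho> \<eta> s0 \<omega> 0 = s0"
| "ssadmm_iter D grad m lam \<rho> \<eta> s0 \<omega> (Suc k) =
     ssadmm_step D grad m lam \<rho> (\<eta> k) (fst (\<omega> k)) (snd (\<omega> k))
       (ssadmm_iter D grad m lam \<rho> \<eta> s0 \<omega> k)"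

definition ssadmm ::
  "(real ^ 'p \<Rightarrow> 'd \<Rightarrow> real ^ 'p) \<Rightarrow> nat \<Rightarrow> nat \<Rightarrow> real \<Rightarrow> real \<Rightarrow> nat \<Rightarrow> (nat \<Rightarrow> real) \<Rightarrow>
   real \<Rightarrow> real ^ 'p \<Rightarrow> real ^ 'p \<Rightarrow> real ^ 'p \<Rightarrow> 'd list \<Rightarrow> (real ^ 'p) measure" where
  "ssadmm grad n m lam \<rho> T \<eta> \<sigma> x0 z0 y0 D =
     distr (PiM {..<T} (\<lambda>_. pair_measure (measure_pmf (pmf_of_set (batches n m))) (gaussian_vec \<sigma>)))
       borel (\<lambda>\<omega>. fst (ssadmm_iter D grad m lam \<rho> \<eta> (x0, z0, y0) \<omega> T))"

definition eps_j :: "real \<Rightarrow> nat \<Rightarrow> real \<Rightarrow> nat \<Rightarrow> real" where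
  "eps_j C m \<sigma> j = real j * (2 * C / real m)\<^sup>2 / (2 * \<sigma>\<^sup>2)"

definition eps_prime :: "real \<Rightarrow> nat \<Rightarrow> nat \<Rightarrow> real \<Rightarrow> nat \<Rightarrow> real" where
  "eps_prime C n m \<sigma> \<alpha> =
    (let q = real m / real n in
     1 / (real \<alpha> - 1) * ln (1 + q\<^sup>2 * real (\<alpha> choose 2) *
         min (4 * (exp (eps_j C m \<sigma> 2) - 1)) (2 * exp (eps_j C m \<sigma> 2))
       + (\<Sum>j = 3..\<alpha>. q ^ j * real (\<alpha> choose j) * 2 * exp ((real j - 1) * eps_j C m \<sigma> j))))"

end

theory Submission
  imports Defs
begin

text \<open>
  Release all the noisy gradients: the output is a data-independent function of them.  Given the
  past, the law of a noisy gradient is a uniform mixture, over the batches, of Gaussians.  For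
  neighbouring datasets differing at index \<open>i\<close>, the mixtures \<open>P\<close> and \<open>Q\<close> differ only in the batches
  containing \<open>i\<close>, so \<open>P - Q\<close> is \<open>q\<close> times an average of differences of Gaussians.  Expand
  \<open>\<integral>(P/Q)\<^bsup>\<alpha>\<^esup> dQ\<close> binomially in \<open>(P - Q)/Q\<close>; the linear term vanishes.  For the others, couple a
  batch \<open>B\<close> containing \<open>i\<close> and an index \<open>l\<close> with the batch \<open>B\<close> if \<open>l \<in> B\<close> and with
  \<open>B - {i} + {l}\<close> otherwise: every batch arises from exactly \<open>m\<close> pairs, so \<open>Q\<close> is an average over
  pairs as well.  Joint convexity of \<open>a\<^sup>j / r\<^bsup>j-1\<^esup>\<close> reduces the estimate to three Gaussians with
  means at mutual distance at most \<open>2C/m\<close>, where it is an explicit computation.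

  The \<open>T\<close> steps are composed using the variational form of the moment bound given by Young's
  inequality.
\<close>

section \<open>Power divergences\<close>

lemma mult_power_divide_eq:
  fixes a r :: "'a :: field"
  assumes "r \<noteq> 0" "j \<ge> 1"
  shows "r * (a / r) ^ j = a ^ j / r ^ (j - 1)"
  using assms by (cases j) (auto simp: power_divide)

lemma power_sum_divide_power_sum_le:
  fixes a r :: "'i \<Rightarrow> real"
  assumes a_nonneg: "\<And>i. i \<in> I \<Longrightarrow> 0 \<le> a i" and r_pos: "\<And>i. i \<in> I \<Longrightarrow> 0 < r i" and j_ge_1: "j \<ge> 1"
  shows "(\<Sum>i\<in>I. a i) ^ j / (\<Sum>i\<in>I. r i) ^ (j - 1) \<le> (\<Sum>i\<in>I. a i ^ j / r i ^ (j - 1))"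
proof (cases "finite I \<and> I \<noteq> {}")
  case True
  define R where "R = sum r I"
  have R_pos: "R > 0" using True r_pos by (auto simp: R_def intro: sum_pos)
  have convex: "convex_on {0::real..} (\<lambda>x. x ^ j)"
    by (cases "even j") (auto intro: convex_on_subset[OF convex_power_even] convex_power_odd)
  have Jensen: "(\<Sum>i\<in>I. (r i / R) *\<^sub>R (a i / r i)) ^ j \<le> (\<Sum>i\<in>I. r i / R * (a i / r i) ^ j)"
    using True a_nonneg r_pos R_pos
    by (intro convex_on_sum[OF _ _ convex])
       (auto simp: R_def sum_divide_distrib[symmetric] less_imp_le intro!: divide_nonneg_pos)
  have r_nonzero: "r i \<noteq> 0" if "i \<in> I" for i
    using r_pos[OF that] by simp
  have "(\<Sum>i\<in>I. a i) ^ j / R ^ (j - 1) = R * ((\<Sum>i\<in>I. a i) / R) ^ j"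
    using R_pos j_ge_1 by (simp add: mult_power_divide_eq)
  also have "(\<Sum>i\<in>I. a i) / R = (\<Sum>i\<in>I. (r i / R) *\<^sub>R (a i / r i))"
    using r_nonzero by (auto simp: sum_divide_distrib intro!: sum.cong)
  also have "R * \<dots> ^ j \<le> R * (\<Sum>i\<in>I. r i / R * (a i / r i) ^ j)"
    using Jensen R_pos by (intro mult_left_mono) auto
  also have "\<dots> = (\<Sum>i\<in>I. r i * (a i / r i) ^ j)"
    using R_pos by (simp add: sum_distrib_left)
  also have "\<dots> = (\<Sum>i\<in>I. a i ^ j / r i ^ (j - 1))"
    using r_nonzero j_ge_1 by (intro sum.cong mult_power_divide_eq) auto
  finally show ?thesis by (simp add: R_def)
qed (use j_ge_1 in \<open>auto simp: power_0_left\<close>)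

lemma power_divide_power_add_le_binomial:
  fixes P Q :: real
  assumes Q_pos: "Q > 0" and \<alpha>_ge_2: "\<alpha> \<ge> 2"
  shows "P ^ \<alpha> / Q ^ (\<alpha> - 1) + real \<alpha> * Q
    \<le> Q + real \<alpha> * P + (\<Sum>j = 2..\<alpha>. real (\<alpha> choose j) * (\<bar>P - Q\<bar> ^ j / Q ^ (j - 1)))"
proof -
  define X where "X = (P - Q) / Q"
  have index_split: "{..\<alpha>} = insert 0 (insert 1 {2..\<alpha>})"
    using \<alpha>_ge_2 by auto
  have "P ^ \<alpha> / Q ^ (\<alpha> - 1) = Q * (X + 1) ^ \<alpha>"
    using Q_pos \<alpha>_ge_2 mult_power_divide_eq[of Q \<alpha> P] by (simp add: X_def diff_divide_distrib)
  also have "\<dots> = (\<Sum>j\<le>\<alpha>. real (\<alpha> choose j) * (Q * X ^ j))"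
    by (simp add: binomial_ring sum_distrib_left mult_ac)
  also have "\<dots> = Q + real \<alpha> * (P - Q) + (\<Sum>j = 2..\<alpha>. real (\<alpha> choose j) * (Q * X ^ j))"
    unfolding index_split using Q_pos \<alpha>_ge_2 by (simp add: X_def)
  also have "(\<Sum>j = 2..\<alpha>. real (\<alpha> choose j) * (Q * X ^ j)) \<le>
      (\<Sum>j = 2..\<alpha>. real (\<alpha> choose j) * (\<bar>P - Q\<bar> ^ j / Q ^ (j - 1)))"
  proof (intro sum_mono mult_left_mono)
    fix j assume "j \<in> {2..\<alpha>}"
    then have "Q * X ^ j = (P - Q) ^ j / Q ^ (j - 1)"
      using Q_pos by (simp add: X_def mult_power_divide_eq)
    also have "\<dots> \<le> \<bar>P - Q\<bar> ^ j / Q ^ (j - 1)"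
      using Q_pos by (intro divide_right_mono) (auto simp flip: power_abs)
    finally show "Q * X ^ j \<le> \<bar>P - Q\<bar> ^ j / Q ^ (j - 1)" .
  qed auto
  finally show ?thesis by (simp add: algebra_simps)
qed

definition power_divergence :: "'a measure \<Rightarrow> nat \<Rightarrow> ('a \<Rightarrow> real) \<Rightarrow> ('a \<Rightarrow> real) \<Rightarrow> ennreal" where
  "power_divergence M j f g = (\<integral>\<^sup>+ x. ennreal (\<bar>f x\<bar> ^ j / g x ^ (j - 1)) \<partial>M)"

lemma power_divergence_cmult:
  assumes [measurable]: "f \<in> borel_measurable M" "g \<in> borel_measurable M" and "d > 0"
  shows "power_divergence M j (\<lambda>x. c * f x) (\<lambda>x. d * g x) =
    ennreal (\<bar>c\<bar> ^ j / d ^ (j - 1)) * power_divergence M j f g"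
proof -
  have "power_divergence M j (\<lambda>x. c * f x) (\<lambda>x. d * g x) =
      (\<integral>\<^sup>+ x. ennreal (\<bar>c\<bar> ^ j / d ^ (j - 1)) * ennreal (\<bar>f x\<bar> ^ j / g x ^ (j - 1)) \<partial>M)"
    unfolding power_divergence_def using \<open>d > 0\<close>
    by (simp add: abs_mult power_mult_distrib flip: ennreal_mult')
  also have "\<dots> = ennreal (\<bar>c\<bar> ^ j / d ^ (j - 1)) * power_divergence M j f g"
    unfolding power_divergence_def by (rule nn_integral_cmult) measurable
  finally show ?thesis .
qed

text \<open>\<open>(a, r) \<mapsto> a\<^sup>j / r\<^bsup>j-1\<^esup>\<close> is convex and homogeneous of degree one, hence subadditive.\<close>

lemma power_divergence_sum_le:
  assumes [measurable]: "\<And>i. i \<in> I \<Longrightarrow> f i \<in> borel_measurable M"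
      "\<And>i. i \<in> I \<Longrightarrow> r i \<in> borel_measurable M"
    and r_pos: "\<And>i x. i \<in> I \<Longrightarrow> r i x > 0" and j_ge_1: "j \<ge> 1"
  shows "power_divergence M j (\<lambda>x. \<Sum>i\<in>I. f i x) (\<lambda>x. \<Sum>i\<in>I. r i x) \<le>
    (\<Sum>i\<in>I. power_divergence M j (f i) (r i))"
proof -
  have "\<bar>\<Sum>i\<in>I. f i x\<bar> ^ j / (\<Sum>i\<in>I. r i x) ^ (j - 1) \<le> (\<Sum>i\<in>I. \<bar>f i x\<bar> ^ j / r i x ^ (j - 1))" for x
  proof -
    have "\<bar>\<Sum>i\<in>I. f i x\<bar> ^ j / (\<Sum>i\<in>I. r i x) ^ (j - 1)
        \<le> (\<Sum>i\<in>I. \<bar>f i x\<bar>) ^ j / (\<Sum>i\<in>I. r i x) ^ (j - 1)"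
      using r_pos
      by (intro divide_right_mono power_mono sum_abs zero_le_power sum_nonneg) (auto simp: less_imp_le)
    also have "\<dots> \<le> (\<Sum>i\<in>I. \<bar>f i x\<bar> ^ j / r i x ^ (j - 1))"
      using r_pos j_ge_1 by (intro power_sum_divide_power_sum_le) auto
    finally show ?thesis .
  qed
  then have "power_divergence M j (\<lambda>x. \<Sum>i\<in>I. f i x) (\<lambda>x. \<Sum>i\<in>I. r i x) \<le>
      (\<integral>\<^sup>+ x. (\<Sum>i\<in>I. ennreal (\<bar>f i x\<bar> ^ j / r i x ^ (j - 1))) \<partial>M)"
    unfolding power_divergence_def using r_pos
    by (intro nn_integral_mono) (auto simp: sum_ennreal less_imp_le intro: ennreal_leI)
  also have "\<dots> = (\<Sum>i\<in>I. power_divergence M j (f i) (r i))"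
    unfolding power_divergence_def by (rule nn_integral_sum) measurable
  finally show ?thesis .
qed

lemma ennreal_power_divide_power_add_le_binomial:
  fixes P Q :: real
  assumes P_nonneg: "P \<ge> 0" and Q_pos: "Q > 0" and \<alpha>_ge_2: "\<alpha> \<ge> 2"
  shows "ennreal (P ^ \<alpha> / Q ^ (\<alpha> - 1)) + ennreal (real \<alpha>) * ennreal Q
    \<le> ennreal Q + ennreal (real \<alpha>) * ennreal P +
      (\<Sum>j = 2..\<alpha>. ennreal (real (\<alpha> choose j)) * ennreal (\<bar>P - Q\<bar> ^ j / Q ^ (j - 1)))"
proof -
  define D where "D j = \<bar>P - Q\<bar> ^ j / Q ^ (j - 1)" for j
  have D_nonneg: "D j \<ge> 0" for j using Q_pos by (simp add: D_def)
  have "ennreal (P ^ \<alpha> / Q ^ (\<alpha> - 1)) + ennreal (real \<alpha>) * ennreal Q =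
      ennreal (P ^ \<alpha> / Q ^ (\<alpha> - 1) + real \<alpha> * Q)"
    using P_nonneg Q_pos by (simp add: ennreal_mult')
  also have "\<dots> \<le> ennreal (Q + real \<alpha> * P + (\<Sum>j = 2..\<alpha>. real (\<alpha> choose j) * D j))"
    unfolding D_def by (intro ennreal_leI power_divide_power_add_le_binomial Q_pos \<alpha>_ge_2)
  also have "\<dots> = ennreal Q + ennreal (real \<alpha>) * ennreal P +
      (\<Sum>j = 2..\<alpha>. ennreal (real (\<alpha> choose j)) * ennreal (D j))"
    using P_nonneg Q_pos D_nonneg
    by (simp add: ennreal_mult'[symmetric] sum_ennreal sum_nonneg)
  finally show ?thesis by (simp only: D_def)
qed

lemma power_divergence_le_binomial:
  assumes [measurable]: "P \<in> borel_measurable M" "Q \<in> borel_measurable M"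
    and P_nonneg: "\<And>x. P x \<ge> 0" and Q_pos: "\<And>x. Q x > 0" and \<alpha>_ge_2: "\<alpha> \<ge> 2"
    and prob: "(\<integral>\<^sup>+ x. ennreal (P x) \<partial>M) = 1" "(\<integral>\<^sup>+ x. ennreal (Q x) \<partial>M) = 1"
  shows "power_divergence M \<alpha> P Q \<le>
    1 + (\<Sum>j = 2..\<alpha>. ennreal (real (\<alpha> choose j)) * power_divergence M j (\<lambda>x. P x - Q x) Q)"
proof -
  define D where "D j x = \<bar>P x - Q x\<bar> ^ j / Q x ^ (j - 1)" for j x
  have [measurable]: "D j \<in> borel_measurable M" for j unfolding D_def by measurable
  have "ennreal (real \<alpha>) + power_divergence M \<alpha> P Q =
      (\<integral>\<^sup>+ x. ennreal (P x ^ \<alpha> / Q x ^ (\<alpha> - 1)) + ennreal (real \<alpha>) * ennreal (Q x) \<partial>M)"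
    using prob P_nonneg
    by (simp add: power_divergence_def nn_integral_add nn_integral_cmult add.commute)
  also have "\<dots> \<le> (\<integral>\<^sup>+ x. ennreal (Q x) + ennreal (real \<alpha>) * ennreal (P x) +
      (\<Sum>j = 2..\<alpha>. ennreal (real (\<alpha> choose j)) * ennreal (D j x)) \<partial>M)"
    unfolding D_def
    by (intro nn_integral_mono ennreal_power_divide_power_add_le_binomial P_nonneg Q_pos \<alpha>_ge_2)
  also have "\<dots> = ennreal (real \<alpha>) +
      (1 + (\<Sum>j = 2..\<alpha>. ennreal (real (\<alpha> choose j)) * power_divergence M j (\<lambda>x. P x - Q x) Q))"
    using prob
    by (simp add: nn_integral_add nn_integral_cmult nn_integral_sum power_divergence_def D_def add_ac)
  finally show ?thesis
    by (simp add: ennreal_add_left_cancel_le)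
qed

lemma power_divergence_diff_le:
  assumes [measurable]: "f \<in> borel_measurable M" "g \<in> borel_measurable M" "r \<in> borel_measurable M"
    and f_nonneg: "\<And>x. f x \<ge> 0" and g_nonneg: "\<And>x. g x \<ge> 0" and r_pos: "\<And>x. r x > 0"
  shows "power_divergence M j (\<lambda>x. f x - g x) r \<le> power_divergence M j f r + power_divergence M j g r"
proof -
  have "\<bar>f x - g x\<bar> ^ j / r x ^ (j - 1) \<le> \<bar>f x\<bar> ^ j / r x ^ (j - 1) + \<bar>g x\<bar> ^ j / r x ^ (j - 1)" for x
  proof -
    have "\<bar>f x - g x\<bar> ^ j \<le> max (f x) (g x) ^ j"
      using f_nonneg[of x] g_nonneg[of x] by (intro power_mono) (auto simp: max_def)
    also have "\<dots> \<le> \<bar>f x\<bar> ^ j + \<bar>g x\<bar> ^ j"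
      using f_nonneg[of x] g_nonneg[of x] by (auto simp: max_def)
    finally show ?thesis
      using r_pos[of x] by (simp add: add_divide_distrib[symmetric] divide_right_mono)
  qed
  then have "power_divergence M j (\<lambda>x. f x - g x) r \<le>
      (\<integral>\<^sup>+ x. ennreal (\<bar>f x\<bar> ^ j / r x ^ (j - 1)) + ennreal (\<bar>g x\<bar> ^ j / r x ^ (j - 1)) \<partial>M)"
    unfolding power_divergence_def using r_pos
    by (intro nn_integral_mono) (auto simp: less_imp_le ennreal_leI simp flip: ennreal_plus)
  also have "\<dots> = power_divergence M j f r + power_divergence M j g r"
    unfolding power_divergence_def by (rule nn_integral_add) measurable
  finally show ?thesis .
qed

lemma square_diff_divide_add_le:
  fixes a b r :: real
  assumes "r > 0"
  shows "(a - b)\<^sup>2 / r + (4 * a + 4 * b) \<le> 2 * (a\<^sup>2 / r) + 2 * (b\<^sup>2 / r) + 4 * r"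
proof -
  have "0 \<le> (a + b - 2 * r)\<^sup>2" by simp
  then have "(a - b)\<^sup>2 + 4 * a * r + 4 * b * r \<le> 2 * a\<^sup>2 + 2 * b\<^sup>2 + 4 * r\<^sup>2"
    by (simp add: power2_eq_square algebra_simps)
  from divide_right_mono[OF this, of r] show ?thesis
    using assms by (simp add: add_divide_distrib power2_eq_square)
qed

lemma power_divergence_2_diff_le:
  assumes [measurable]: "f \<in> borel_measurable M" "g \<in> borel_measurable M" "r \<in> borel_measurable M"
    and f_nonneg: "\<And>x. f x \<ge> 0" and g_nonneg: "\<And>x. g x \<ge> 0" and r_pos: "\<And>x. r x > 0"
    and prob: "(\<integral>\<^sup>+ x. ennreal (f x) \<partial>M) = 1" "(\<integral>\<^sup>+ x. ennreal (g x) \<partial>M) = 1"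
      "(\<integral>\<^sup>+ x. ennreal (r x) \<partial>M) = 1"
    and f_r: "power_divergence M 2 f r \<le> ennreal K" and g_r: "power_divergence M 2 g r \<le> ennreal K"
    and K_ge_1: "K \<ge> 1"
  shows "power_divergence M 2 (\<lambda>x. f x - g x) r \<le> ennreal (4 * (K - 1))"
proof -
  have pointwise: "ennreal ((f x - g x)\<^sup>2 / r x) + (4 * ennreal (f x) + 4 * ennreal (g x)) \<le>
      2 * ennreal ((f x)\<^sup>2 / r x) + 2 * ennreal ((g x)\<^sup>2 / r x) + 4 * ennreal (r x)" for x
    using ennreal_leI[OF square_diff_divide_add_le[OF r_pos, of "f x" "g x" x]]
      f_nonneg[of x] g_nonneg[of x] r_pos[of x]
    by (simp add: ennreal_mult' del: times_divide_eq_right)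
  have "8 + power_divergence M 2 (\<lambda>x. f x - g x) r =
      (\<integral>\<^sup>+ x. ennreal ((f x - g x)\<^sup>2 / r x) + (4 * ennreal (f x) + 4 * ennreal (g x)) \<partial>M)"
    using prob by (simp add: power_divergence_def nn_integral_add nn_integral_cmult add.commute)
  also have "\<dots> \<le>
      (\<integral>\<^sup>+ x. 2 * ennreal ((f x)\<^sup>2 / r x) + 2 * ennreal ((g x)\<^sup>2 / r x) + 4 * ennreal (r x) \<partial>M)"
    by (intro nn_integral_mono pointwise)
  also have "\<dots> = 2 * power_divergence M 2 f r + 2 * power_divergence M 2 g r + 4"
    using prob by (simp add: power_divergence_def nn_integral_add nn_integral_cmult)
  also have "\<dots> \<le> 2 * ennreal K + 2 * ennreal K + 4"
    using f_r g_r by (intro add_mono mult_left_mono) auto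
  also have "\<dots> = ennreal (2 * K + 2 * K + 4)"
    using K_ge_1 by (simp add: ennreal_mult' flip: distrib_right)
  also have "\<dots> = 8 + ennreal (4 * (K - 1))"
    using K_ge_1 by (simp flip: ennreal_numeral ennreal_plus)
  finally show ?thesis
    by (simp add: ennreal_add_left_cancel_le)
qed

section \<open>Batches\<close>

definition swap_index :: "'a \<Rightarrow> 'a set \<Rightarrow> 'a \<Rightarrow> 'a set" where
  "swap_index i B l = (if l \<in> B then B else insert l (B - {i}))"

lemma mem_swap_index: "l \<in> swap_index i B l"
  by (simp add: swap_index_def)

lemma swap_index_swap_index: "i \<in> B \<Longrightarrow> swap_index l (swap_index i B l) i = B"
  by (auto simp: swap_index_def)

lemma finite_batches [simp]: "finite (batches n m)"
  unfolding batches_def by (rule finite_subset[of _ "Pow {..<n}"]) auto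

lemma batches_finite: "B \<in> batches n m \<Longrightarrow> finite B"
  by (auto simp: batches_def intro: finite_subset)

lemma batches_nonempty: "m \<le> n \<Longrightarrow> batches n m \<noteq> {}"
  using card_lessThan[of m] by (auto simp: batches_def intro!: exI[of _ "{..<m}"])

lemma card_batches_pos: "m \<le> n \<Longrightarrow> card (batches n m) > 0"
  by (simp add: card_gt_0_iff batches_nonempty)

lemma swap_index_in_batches:
  assumes "B \<in> batches n m" "i \<in> B" "l < n"
  shows "swap_index i B l \<in> batches n m"
proof -
  have "finite B" using assms(1) by (rule batches_finite)
  moreover have "card B > 0" using \<open>finite B\<close> assms(2) by (auto simp: card_gt_0_iff)
  ultimately show ?thesis
    using assms by (auto simp: swap_index_def batches_def)
qed

lemma bij_betw_swap_index:
  assumes "i < n"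
  shows "bij_betw (\<lambda>(B, l). (swap_index i B l, l))
    (SIGMA B:{B \<in> batches n m. i \<in> B}. {..<n}) (SIGMA B:batches n m. B)"
proof (rule bij_betw_byWitness[where f' = "\<lambda>(B, l). (swap_index l B i, l)"])
  show "(\<lambda>(B, l). (swap_index l B i, l)) ` (SIGMA B:batches n m. B) \<subseteq>
      (SIGMA B:{B \<in> batches n m. i \<in> B}. {..<n})"
    using assms by (auto simp: swap_index_in_batches mem_swap_index) (auto simp: batches_def)
qed (auto simp: swap_index_swap_index mem_swap_index swap_index_in_batches)

lemma sum_swap_index:
  fixes F :: "nat set \<Rightarrow> 'a :: comm_semiring_1"
  assumes "i < n"
  shows "(\<Sum>B\<in>{B \<in> batches n m. i \<in> B}. \<Sum>l<n. F (swap_index i B l)) =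
    of_nat m * (\<Sum>B\<in>batches n m. F B)"
proof -
  have "(\<Sum>B\<in>{B \<in> batches n m. i \<in> B}. \<Sum>l<n. F (swap_index i B l)) =
      (\<Sum>(B, l)\<in>(SIGMA B:{B \<in> batches n m. i \<in> B}. {..<n}). F (swap_index i B l))"
    by (subst sum.Sigma) auto
  also have "\<dots> = (\<Sum>(B, l)\<in>(SIGMA B:batches n m. B). F B)"
    using sum.reindex_bij_betw[OF bij_betw_swap_index[OF assms], where g = "\<lambda>(B, l). F B"]
    by (simp add: case_prod_unfold)
  also have "\<dots> = (\<Sum>B\<in>batches n m. \<Sum>l\<in>B. F B)"
    by (subst sum.Sigma) (auto intro: batches_finite)
  also have "\<dots> = (\<Sum>B\<in>batches n m. of_nat m * F B)"
    by (intro sum.cong) (auto simp: batches_def)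
  finally show ?thesis by (simp add: sum_distrib_left)
qed

lemma card_batches_containing:
  assumes "i < n"
  shows "n * card {B \<in> batches n m. i \<in> B} = m * card (batches n m)"
  using sum_swap_index[OF assms, where m = m and F = "\<lambda>_. 1 :: nat"] by (simp add: mult.commute)

definition batch_mixture :: "nat \<Rightarrow> nat \<Rightarrow> (nat set \<Rightarrow> 'a \<Rightarrow> real) \<Rightarrow> 'a \<Rightarrow> real" where
  "batch_mixture n m p x = (\<Sum>B\<in>batches n m. p B x) / real (card (batches n m))"

lemma borel_measurable_batch_mixture [measurable]:
  assumes [measurable]: "\<And>B. p B \<in> borel_measurable M"
  shows "batch_mixture n m p \<in> borel_measurable M"
  unfolding batch_mixture_def by measurable

lemma batch_mixture_pos:
  assumes "m \<le> n" "\<And>B. p B x > 0"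
  shows "batch_mixture n m p x > 0"
  unfolding batch_mixture_def using assms batches_nonempty[of m n] card_batches_pos[of m n]
  by (intro divide_pos_pos sum_pos) auto

lemma nn_integral_batch_mixture_mult:
  assumes [measurable]: "\<And>B. p B \<in> borel_measurable M" "f \<in> borel_measurable M"
    and p_nonneg: "\<And>B x. p B x \<ge> 0"
  shows "(\<integral>\<^sup>+ x. ennreal (batch_mixture n m p x) * f x \<partial>M) =
    (\<Sum>B\<in>batches n m. \<integral>\<^sup>+ x. ennreal (p B x) * f x \<partial>M) * ennreal (1 / real (card (batches n m)))"
proof -
  have "(\<integral>\<^sup>+ x. ennreal (batch_mixture n m p x) * f x \<partial>M) =
      (\<integral>\<^sup>+ x. (\<Sum>B\<in>batches n m. ennreal (p B x) * f x) * ennreal (1 / real (card (batches n m))) \<partial>M)"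
    using p_nonneg by (intro nn_integral_cong)
      (simp add: batch_mixture_def divide_inverse ennreal_mult'' sum_ennreal[symmetric]
        sum_distrib_left sum_distrib_right mult_ac sum_nonneg)
  also have "\<dots> = (\<Sum>B\<in>batches n m. \<integral>\<^sup>+ x. ennreal (p B x) * f x \<partial>M) *
      ennreal (1 / real (card (batches n m)))"
    by (simp add: nn_integral_multc nn_integral_sum)
  finally show ?thesis .
qed

lemma nn_integral_batch_mixture:
  assumes [measurable]: "\<And>B. p B \<in> borel_measurable M" and p_nonneg: "\<And>B x. p B x \<ge> 0"
    and prob: "\<And>B. (\<integral>\<^sup>+ x. ennreal (p B x) \<partial>M) = 1" and m_le: "m \<le> n"
  shows "(\<integral>\<^sup>+ x. ennreal (batch_mixture n m p x) \<partial>M) = 1"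
  using nn_integral_batch_mixture_mult[of p M "\<lambda>_. 1" n m] p_nonneg prob batches_nonempty[OF m_le]
  by (simp add: ennreal_of_nat_eq_real_of_nat flip: ennreal_mult')

section \<open>Privacy amplification by subsampling\<close>

context
  fixes M :: "'a measure" and p p' :: "nat set \<Rightarrow> 'a \<Rightarrow> real" and n m i :: nat
  assumes borel_measurable_densities [measurable]:
      "\<And>B. p B \<in> borel_measurable M" "\<And>B. p' B \<in> borel_measurable M"
    and densities_pos: "\<And>B x. p B x > 0" "\<And>B x. p' B x > 0"
    and batch_size: "1 \<le> m" "m \<le> n"
    and index: "i < n"
    and densities_eq: "\<And>B. B \<in> batches n m \<Longrightarrow> i \<notin> B \<Longrightarrow> p B = p' B"
begin

private abbreviation "swaps \<equiv> {B \<in> batches n m. i \<in> B} \<times> {..<n}"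
private abbreviation "weight \<equiv> 1 / (real m * real (card (batches n m)))"

private lemma batch_mixture_diff_eq_sum_swaps:
  "batch_mixture n m p x - batch_mixture n m p' x =
    real m / real n * weight * (\<Sum>(B, l)\<in>swaps. p B x - p' B x)"
proof -
  have "(\<Sum>B\<in>batches n m. p B x - p' B x) = (\<Sum>B\<in>{B \<in> batches n m. i \<in> B}. p B x - p' B x)"
    by (rule sum.mono_neutral_right) (auto simp: densities_eq)
  moreover have "(\<Sum>(B, l)\<in>swaps. p B x - p' B x) =
      real n * (\<Sum>B\<in>{B \<in> batches n m. i \<in> B}. p B x - p' B x)"
    by (simp add: sum.cartesian_product[symmetric] sum_distrib_left[symmetric])
  ultimately show ?thesis
    using batch_size
    by (simp add: batch_mixture_def sum_subtractf[symmetric] diff_divide_distrib[symmetric])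
qed

private lemma batch_mixture_eq_sum_swaps:
  "batch_mixture n m p' x = weight * (\<Sum>(B, l)\<in>swaps. p' (swap_index i B l) x)"
  using sum_swap_index[OF index, where F = "\<lambda>B. p' B x" and m = m] batch_size
  by (simp add: batch_mixture_def sum.cartesian_product[symmetric])

private lemma card_swaps_mult_weight: "real (card swaps) * weight = 1"
proof -
  have "real (n * card {B \<in> batches n m. i \<in> B}) = real (m * card (batches n m))"
    by (simp only: card_batches_containing[OF index])
  then show ?thesis
    using batch_size by (simp add: batches_nonempty mult.commute)
qed

lemma power_divergence_batch_mixture_diff_le:
  assumes ternary: "\<And>B l. B \<in> batches n m \<Longrightarrow> i \<in> B \<Longrightarrow> l < n \<Longrightarrow>
      power_divergence M j (\<lambda>x. p B x - p' B x) (p' (swap_index i B l)) \<le> ennreal Z"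
    and Z_nonneg: "Z \<ge> 0" and j_ge_1: "j \<ge> 1"
  shows "power_divergence M j
      (\<lambda>x. batch_mixture n m p x - batch_mixture n m p' x) (batch_mixture n m p')
    \<le> ennreal ((real m / real n) ^ j * Z)"
proof -
  define q where "q = real m / real n"
  define w where "w = weight"
  have q_pos: "q > 0" using batch_size by (simp add: q_def)
  have w_pos: "w > 0" using batch_size card_batches_pos[of m n] by (simp add: w_def)
  have total_weight: "real (card swaps) * w = 1" unfolding w_def by (rule card_swaps_mult_weight)
  have "power_divergence M j
      (\<lambda>x. batch_mixture n m p x - batch_mixture n m p' x) (batch_mixture n m p') =
      power_divergence M j (\<lambda>x. q * w * (\<Sum>(B, l)\<in>swaps. p B x - p' B x))
        (\<lambda>x. w * (\<Sum>(B, l)\<in>swaps. p' (swap_index i B l) x))"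
    unfolding batch_mixture_diff_eq_sum_swaps
    unfolding batch_mixture_eq_sum_swaps[abs_def] q_def w_def ..
  also have "\<dots> = ennreal (\<bar>q * w\<bar> ^ j / w ^ (j - 1)) *
      power_divergence M j (\<lambda>x. \<Sum>(B, l)\<in>swaps. p B x - p' B x)
        (\<lambda>x. \<Sum>(B, l)\<in>swaps. p' (swap_index i B l) x)"
    using w_pos by (intro power_divergence_cmult) (auto simp: case_prod_unfold)
  also have "\<bar>q * w\<bar> ^ j / w ^ (j - 1) = q ^ j * w"
    using q_pos w_pos j_ge_1 by (cases j) (auto simp: abs_mult power_mult_distrib)
  also have "power_divergence M j (\<lambda>x. \<Sum>(B, l)\<in>swaps. p B x - p' B x)
        (\<lambda>x. \<Sum>(B, l)\<in>swaps. p' (swap_index i B l) x) \<le>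
      (\<Sum>(B, l)\<in>swaps. power_divergence M j (\<lambda>x. p B x - p' B x) (p' (swap_index i B l)))"
    unfolding case_prod_unfold using densities_pos j_ge_1 by (intro power_divergence_sum_le) auto
  also have "\<dots> \<le> (\<Sum>(B, l)\<in>swaps. ennreal Z)"
    by (intro sum_mono) (auto intro: ternary)
  also have "\<dots> = ennreal (real (card swaps) * Z)"
    by (simp add: case_prod_unfold ennreal_mult' ennreal_of_nat_eq_real_of_nat)
  also have "ennreal (q ^ j * w) * \<dots> = ennreal (q ^ j * Z * (real (card swaps) * w))"
    using q_pos w_pos Z_nonneg by (simp add: mult_ac flip: ennreal_mult')
  finally show ?thesis
    unfolding total_weight q_def by (simp add: mult_left_mono)
qed

lemma power_divergence_batch_mixture_le:
  assumes prob: "\<And>B. (\<integral>\<^sup>+ x. ennreal (p B x) \<partial>M) = 1" "\<And>B. (\<integral>\<^sup>+ x. ennreal (p' B x) \<partial>M) = 1"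
    and ternary: "\<And>j B l. j \<in> {2..\<alpha>} \<Longrightarrow> B \<in> batches n m \<Longrightarrow> i \<in> B \<Longrightarrow> l < n \<Longrightarrow>
      power_divergence M j (\<lambda>x. p B x - p' B x) (p' (swap_index i B l)) \<le> ennreal (Z j)"
    and Z_nonneg: "\<And>j. Z j \<ge> 0" and \<alpha>_ge_2: "\<alpha> \<ge> 2"
  shows "power_divergence M \<alpha> (batch_mixture n m p) (batch_mixture n m p') \<le>
    ennreal (1 + (\<Sum>j = 2..\<alpha>. real (\<alpha> choose j) * ((real m / real n) ^ j * Z j)))"
proof -
  let ?P = "batch_mixture n m p" and ?Q = "batch_mixture n m p'"
  have "power_divergence M \<alpha> ?P ?Q \<le>
      1 + (\<Sum>j = 2..\<alpha>. ennreal (real (\<alpha> choose j)) * power_divergence M j (\<lambda>x. ?P x - ?Q x) ?Q)"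
    using densities_pos prob batch_size \<alpha>_ge_2
    by (intro power_divergence_le_binomial)
       (auto simp: less_imp_le nn_integral_batch_mixture batch_mixture_pos)
  also have "\<dots> \<le>
      1 + (\<Sum>j = 2..\<alpha>. ennreal (real (\<alpha> choose j)) * ennreal ((real m / real n) ^ j * Z j))"
    using ternary Z_nonneg
    by (intro add_left_mono sum_mono mult_left_mono power_divergence_batch_mixture_diff_le) auto
  also have "\<dots> = ennreal (1 + (\<Sum>j = 2..\<alpha>. real (\<alpha> choose j) * ((real m / real n) ^ j * Z j)))"
    using Z_nonneg by (simp add: sum_ennreal sum_nonneg flip: ennreal_mult')
  finally show ?thesis .
qed

end

section \<open>Gaussian densities\<close>

definition gauss_density :: "real \<Rightarrow> 'a :: euclidean_space \<Rightarrow> 'a \<Rightarrow> real" where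
  "gauss_density \<sigma> v x = (1 / sqrt (2 * pi * \<sigma>\<^sup>2)) ^ DIM('a) * exp (- (norm (x - v))\<^sup>2 / (2 * \<sigma>\<^sup>2))"

lemma gauss_density_pos: "\<sigma> > 0 \<Longrightarrow> gauss_density \<sigma> v x > 0"
  by (simp add: gauss_density_def)

lemma borel_measurable_gauss_density [measurable]: "gauss_density \<sigma> v \<in> borel_measurable borel"
  unfolding gauss_density_def by measurable

lemma gauss_density_eq_prod_normal_density:
  fixes v :: "'a :: euclidean_space"
  shows "gauss_density \<sigma> v x = (\<Prod>b\<in>Basis. normal_density (v \<bullet> b) \<sigma> (x \<bullet> b))"
proof -
  have "(norm (x - v))\<^sup>2 = (\<Sum>b\<in>Basis. (x \<bullet> b - v \<bullet> b)\<^sup>2)"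
    by (subst euclidean_inner[of "x - v" "x - v"] power2_norm_eq_inner)+
       (simp add: inner_diff_left power2_eq_square)
  then show ?thesis
    by (simp add: gauss_density_def normal_density_def prod.distrib exp_sum[symmetric] sum_negf
        sum_divide_distrib prod_dividef power_one_over)
qed

lemma nn_integral_gauss_density:
  fixes v :: "'a :: euclidean_space"
  assumes "\<sigma> > 0"
  shows "(\<integral>\<^sup>+ x. ennreal (gauss_density \<sigma> v x) \<partial>lborel) = 1"
proof -
  have "(\<integral>\<^sup>+ x. ennreal (gauss_density \<sigma> v x) \<partial>lborel) =
      (\<integral>\<^sup>+ x. (\<Prod>b\<in>Basis. ennreal (normal_density (v \<bullet> b) \<sigma> (x \<bullet> b))) \<partial>lborel)"
    by (simp add: gauss_density_eq_prod_normal_density prod_ennreal)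
  also have "\<dots> = (\<Prod>b\<in>(Basis :: 'a set). \<integral>\<^sup>+ t. ennreal (normal_density (v \<bullet> b) \<sigma> t) \<partial>lborel)"
    by (rule nn_integral_lborel_prod) auto
  also have "\<dots> = 1"
    using assms by (simp add: nn_integral_eq_integral integrable_normal_density)
  finally show ?thesis .
qed

lemma distr_gauss_density_plus:
  fixes u v :: "'a :: euclidean_space"
  shows "distr (density lborel (gauss_density \<sigma> v)) borel ((+) u) =
    density lborel (gauss_density \<sigma> (u + v))"
proof -
  have "density lborel (gauss_density \<sigma> (u + v)) =
      density (distr lborel borel ((+) u)) (gauss_density \<sigma> (u + v))"
    by (simp add: lborel_distr_plus)
  also have "\<dots> = distr (density lborel (\<lambda>x. gauss_density \<sigma> (u + v) (u + x))) borel ((+) u)"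
    by (rule density_distr) measurable
  also have "(\<lambda>x. gauss_density \<sigma> (u + v) (u + x)) = gauss_density \<sigma> v"
    by (simp add: gauss_density_def fun_eq_iff)
  finally show ?thesis ..
qed

text \<open>Completing the square: the tilted density is again Gaussian.\<close>

lemma gauss_density_power_ratio:
  fixes a b x :: "'a :: euclidean_space"
  assumes \<sigma>_pos: "\<sigma> > 0" and j_ge_1: "j \<ge> 1"
  shows "gauss_density \<sigma> a x ^ j / gauss_density \<sigma> b x ^ (j - 1) =
    exp (real j * (real j - 1) * (norm (a - b))\<^sup>2 / (2 * \<sigma>\<^sup>2)) *
    gauss_density \<sigma> (real j *\<^sub>R a - (real j - 1) *\<^sub>R b) x"
proof -
  define v where "v = real j *\<^sub>R a - (real j - 1) *\<^sub>R b"
  define c where "c = (1 / sqrt (2 * pi * \<sigma>\<^sup>2)) ^ DIM('a)"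
  have c_pos: "c > 0" using \<sigma>_pos by (simp add: c_def)
  have density: "gauss_density \<sigma> w x = c * exp (- (norm (x - w))\<^sup>2 / (2 * \<sigma>\<^sup>2))" for w
    by (simp add: gauss_density_def c_def)
  have square: "real j * (norm (x - a))\<^sup>2 - (real j - 1) * (norm (x - b))\<^sup>2 =
      (norm (x - v))\<^sup>2 - real j * (real j - 1) * (norm (a - b))\<^sup>2"
    unfolding v_def power2_norm_eq_inner
    by (simp add: inner_diff_left inner_diff_right inner_commute algebra_simps)
  have "(c * exp s) ^ j / (c * exp t) ^ (j - 1) = c * exp (real j * s - (real j - 1) * t)" for s t
    using c_pos j_ge_1
    by (cases j) (simp_all add: power_mult_distrib distrib_right exp_diff exp_add exp_of_nat_mult)
  then have "gauss_density \<sigma> a x ^ j / gauss_density \<sigma> b x ^ (j - 1) =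
      c * exp (real j * (- (norm (x - a))\<^sup>2 / (2 * \<sigma>\<^sup>2)) -
        (real j - 1) * (- (norm (x - b))\<^sup>2 / (2 * \<sigma>\<^sup>2)))"
    by (simp only: density)
  also have "\<dots> =
      c * exp (- (real j * (norm (x - a))\<^sup>2 - (real j - 1) * (norm (x - b))\<^sup>2) / (2 * \<sigma>\<^sup>2))"
    by (simp add: diff_divide_distrib)
  also have "\<dots> = exp (real j * (real j - 1) * (norm (a - b))\<^sup>2 / (2 * \<sigma>\<^sup>2)) * gauss_density \<sigma> v x"
    unfolding square density by (simp add: diff_divide_distrib mult_exp_exp flip: exp_add)
  finally show ?thesis by (simp add: v_def)
qed

lemma power_divergence_gauss_density:
  fixes a b :: "'a :: euclidean_space"
  assumes \<sigma>_pos: "\<sigma> > 0" and j_ge_1: "j \<ge> 1"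
  shows "power_divergence lborel j (gauss_density \<sigma> a) (gauss_density \<sigma> b) =
    ennreal (exp (real j * (real j - 1) * (norm (a - b))\<^sup>2 / (2 * \<sigma>\<^sup>2)))"
  using \<sigma>_pos j_ge_1
  by (simp add: power_divergence_def gauss_density_pos less_imp_le gauss_density_power_ratio[simplified]
      ennreal_mult' nn_integral_cmult nn_integral_gauss_density)

definition ternary_gauss_bound :: "real \<Rightarrow> real \<Rightarrow> nat \<Rightarrow> real" where
  "ternary_gauss_bound \<sigma> \<Delta> j =
    (let e = exp (real j * (real j - 1) * \<Delta>\<^sup>2 / (2 * \<sigma>\<^sup>2))
     in if j = 2 then min (4 * (e - 1)) (2 * e) else 2 * e)"

lemma ternary_gauss_bound_nonneg: "ternary_gauss_bound \<sigma> \<Delta> j \<ge> 0"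
  by (simp add: ternary_gauss_bound_def Let_def)

lemma power_divergence_gauss_density_diff_le:
  fixes a b c :: "'a :: euclidean_space"
  assumes \<sigma>_pos: "\<sigma> > 0" and j_ge_1: "j \<ge> 1"
    and a_close: "norm (a - c) \<le> \<Delta>" and b_close: "norm (b - c) \<le> \<Delta>"
  shows "power_divergence lborel j
      (\<lambda>x. gauss_density \<sigma> a x - gauss_density \<sigma> b x) (gauss_density \<sigma> c)
    \<le> ennreal (ternary_gauss_bound \<sigma> \<Delta> j)"
proof -
  define e where "e = exp (real j * (real j - 1) * \<Delta>\<^sup>2 / (2 * \<sigma>\<^sup>2))"
  have e_ge_1: "e \<ge> 1" using j_ge_1 by (simp add: e_def)
  have pairwise: "power_divergence lborel j (gauss_density \<sigma> v) (gauss_density \<sigma> c) \<le> ennreal e"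
    if "norm (v - c) \<le> \<Delta>" for v
  proof -
    have "real j * (real j - 1) * (norm (v - c))\<^sup>2 / (2 * \<sigma>\<^sup>2) \<le>
        real j * (real j - 1) * \<Delta>\<^sup>2 / (2 * \<sigma>\<^sup>2)"
      using that j_ge_1 by (intro divide_right_mono mult_left_mono power_mono) auto
    then show ?thesis
      unfolding power_divergence_gauss_density[OF \<sigma>_pos j_ge_1] e_def by (intro ennreal_leI) simp
  qed
  have "power_divergence lborel j
      (\<lambda>x. gauss_density \<sigma> a x - gauss_density \<sigma> b x) (gauss_density \<sigma> c) \<le>
      power_divergence lborel j (gauss_density \<sigma> a) (gauss_density \<sigma> c) +
      power_divergence lborel j (gauss_density \<sigma> b) (gauss_density \<sigma> c)"
    using \<sigma>_pos by (intro power_divergence_diff_le) (auto simp: gauss_density_pos less_imp_le)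
  also have "\<dots> \<le> ennreal e + ennreal e"
    using a_close b_close by (intro add_mono pairwise)
  also have "\<dots> = ennreal (2 * e)"
    using e_ge_1 by (simp flip: ennreal_plus)
  finally have general: "power_divergence lborel j
      (\<lambda>x. gauss_density \<sigma> a x - gauss_density \<sigma> b x) (gauss_density \<sigma> c) \<le> ennreal (2 * e)" .
  have "power_divergence lborel 2
      (\<lambda>x. gauss_density \<sigma> a x - gauss_density \<sigma> b x) (gauss_density \<sigma> c) \<le>
      ennreal (4 * (e - 1))" if "j = 2"
    using pairwise[OF a_close] pairwise[OF b_close] e_ge_1 \<sigma>_pos that
    by (intro power_divergence_2_diff_le)
       (auto simp: gauss_density_pos less_imp_le nn_integral_gauss_density)
  with general show ?thesis
    by (auto simp: ternary_gauss_bound_def Let_def e_def min_def)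
qed

section \<open>The subsampled Gaussian mechanism\<close>

definition subsampled_gauss_bound :: "real \<Rightarrow> real \<Rightarrow> real \<Rightarrow> nat \<Rightarrow> real" where
  "subsampled_gauss_bound q \<sigma> \<Delta> \<alpha> =
    1 + (\<Sum>j = 2..\<alpha>. real (\<alpha> choose j) * (q ^ j * ternary_gauss_bound \<sigma> \<Delta> j))"

lemma subsampled_gauss_bound_ge_1: "q \<ge> 0 \<Longrightarrow> subsampled_gauss_bound q \<sigma> \<Delta> \<alpha> \<ge> 1"
  by (simp add: subsampled_gauss_bound_def sum_nonneg ternary_gauss_bound_nonneg)

lemma eps_prime_eq_ln_subsampled_gauss_bound:
  assumes "\<alpha> \<ge> 2"
  shows "eps_prime C n m \<sigma> \<alpha> =
    ln (subsampled_gauss_bound (real m / real n) \<sigma> (2 * C / real m) \<alpha>) / (real \<alpha> - 1)"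
proof -
  have index_split: "{2..\<alpha>} = insert 2 {3..\<alpha>}" using assms by auto
  show ?thesis
    unfolding eps_prime_def subsampled_gauss_bound_def index_split
    by (auto simp: Let_def eps_j_def ternary_gauss_bound_def mult_ac
        intro!: arg_cong[where f = ln] sum.cong)
qed

lemma power_divergence_subsampled_gauss_le:
  fixes u u' :: "nat set \<Rightarrow> 'a :: euclidean_space"
  assumes "\<sigma> > 0" and "1 \<le> m" "m \<le> n" and "i < n" and "\<alpha> \<ge> 2"
    and "\<And>B. B \<in> batches n m \<Longrightarrow> i \<notin> B \<Longrightarrow> u B = u' B"
    and "\<And>B l. B \<in> batches n m \<Longrightarrow> i \<in> B \<Longrightarrow> l < n \<Longrightarrow> norm (u B - u' (swap_index i B l)) \<le> \<Delta>"
      "\<And>B l. B \<in> batches n m \<Longrightarrow> i \<in> B \<Longrightarrow> l < n \<Longrightarrow> norm (u' B - u' (swap_index i B l)) \<le> \<Delta>"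
  shows "power_divergence lborel \<alpha> (batch_mixture n m (\<lambda>B. gauss_density \<sigma> (u B)))
      (batch_mixture n m (\<lambda>B. gauss_density \<sigma> (u' B)))
    \<le> ennreal (subsampled_gauss_bound (real m / real n) \<sigma> \<Delta> \<alpha>)"
  unfolding subsampled_gauss_bound_def
  using assms
  by (intro power_divergence_batch_mixture_le[where i = i] power_divergence_gauss_density_diff_le)
     (auto simp: gauss_density_pos nn_integral_gauss_density ternary_gauss_bound_nonneg)

section \<open>Dual form of the moment bound\<close>

lemma Youngs_inequality_power:
  fixes a b :: real
  assumes "a \<ge> 0" "b \<ge> 0"
  shows "real n * (b ^ (n - 1) * a) \<le> real (n - 1) * b ^ n + a ^ n"
proof (cases "b = 0 \<or> n = 0")
  case True
  then show ?thesis using assms by (cases "n = 1") (auto simp: power_0_left)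
next
  case False
  then have b_pos: "b > 0" and n_pos: "n > 0" using assms by auto
  have power_pred: "b ^ n = b * b ^ (n - 1)" using n_pos by (cases n) auto
  have "-1 \<le> a / b - 1" using assms b_pos by simp
  from Bernoulli_inequality[OF this, of n] have "1 + real n * (a / b - 1) \<le> (a / b) ^ n" by simp
  then have "b ^ n * (1 + real n * (a / b - 1)) \<le> b ^ n * (a / b) ^ n"
    using b_pos by (intro mult_left_mono) auto
  moreover have "b ^ n * (a / b) ^ n = a ^ n" using b_pos by (simp add: power_divide)
  moreover have "b ^ n * (1 + real n * (a / b - 1)) =
      real n * (b ^ (n - 1) * a) - real (n - 1) * b ^ n"
    using b_pos n_pos by (simp add: power_pred of_nat_diff algebra_simps)
  ultimately show ?thesis by linarith
qed

lemma Youngs_inequality_power_ennreal: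
  fixes a b :: ennreal
  shows "of_nat n * (b ^ (n - 1) * a) \<le> of_nat (n - 1) * b ^ n + a ^ n"
proof (cases "n = 0 \<or> a = top \<or> b = top")
  case True
  then consider "n = 0" | "n = 1" | "n > 1" "a = top" | "n > 1" "b = top"
    by (cases "n > 1") (auto simp: not_less le_Suc_eq)
  then show ?thesis by cases (auto simp: ennreal_mult_top ennreal_top_mult_left power_top_ennreal)
next
  case False
  then obtain x y where "a = ennreal x" "b = ennreal y" "x \<ge> 0" "y \<ge> 0"
    by (cases a; cases b) auto
  then show ?thesis
    using Youngs_inequality_power[of x y n]
    by (simp add: ennreal_power ennreal_of_nat_eq_real_of_nat flip: ennreal_mult' ennreal_plus)
qed

text \<open>Taking \<open>\<phi> = dP/dQ\<close>, the equality case of Young's inequality, gives \<open>\<integral>(dP/dQ)\<^bsup>\<alpha>\<^esup> dQ \<le> K\<close>.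
  The form without densities passes to images and kernel compositions.\<close>

definition renyi_moment_le :: "nat \<Rightarrow> 'a measure \<Rightarrow> 'a measure \<Rightarrow> real \<Rightarrow> bool" where
  "renyi_moment_le \<alpha> P Q K \<longleftrightarrow> sets P = sets Q \<and>
    (\<forall>\<phi> \<in> borel_measurable P. of_nat \<alpha> * (\<integral>\<^sup>+ x. \<phi> x ^ (\<alpha> - 1) \<partial>P) \<le>
      of_nat (\<alpha> - 1) * (\<integral>\<^sup>+ x. \<phi> x ^ \<alpha> \<partial>Q) + ennreal K)"

lemma renyi_moment_leI:
  assumes "sets P = sets Q"
    and "\<And>\<phi>. \<phi> \<in> borel_measurable P \<Longrightarrow> of_nat \<alpha> * (\<integral>\<^sup>+ x. \<phi> x ^ (\<alpha> - 1) \<partial>P) \<le>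
      of_nat (\<alpha> - 1) * (\<integral>\<^sup>+ x. \<phi> x ^ \<alpha> \<partial>Q) + ennreal K"
  shows "renyi_moment_le \<alpha> P Q K"
  using assms by (simp add: renyi_moment_le_def)

lemma renyi_moment_le_sets: "renyi_moment_le \<alpha> P Q K \<Longrightarrow> sets P = sets Q"
  by (simp add: renyi_moment_le_def)

lemma renyi_moment_leD:
  assumes "renyi_moment_le \<alpha> P Q K" "\<phi> \<in> borel_measurable P"
  shows "of_nat \<alpha> * (\<integral>\<^sup>+ x. \<phi> x ^ (\<alpha> - 1) \<partial>P) \<le>
    of_nat (\<alpha> - 1) * (\<integral>\<^sup>+ x. \<phi> x ^ \<alpha> \<partial>Q) + ennreal K"
  using assms by (simp add: renyi_moment_le_def)

lemma renyi_moment_le_density: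
  assumes [measurable]: "f \<in> borel_measurable M" "g \<in> borel_measurable M"
    and f_nonneg: "\<And>x. f x \<ge> 0" and g_pos: "\<And>x. g x > 0" and \<alpha>_ge_1: "\<alpha> \<ge> 1"
    and divergence_le: "power_divergence M \<alpha> f g \<le> ennreal K"
  shows "renyi_moment_le \<alpha> (density M f) (density M g) K"
proof (rule renyi_moment_leI)
  fix \<phi> :: "'a \<Rightarrow> ennreal" assume "\<phi> \<in> borel_measurable (density M f)"
  then have [measurable]: "\<phi> \<in> borel_measurable M" by simp
  have Young: "of_nat \<alpha> * (ennreal (f x) * \<phi> x ^ (\<alpha> - 1)) \<le>
      of_nat (\<alpha> - 1) * (ennreal (g x) * \<phi> x ^ \<alpha>) + ennreal (\<bar>f x\<bar> ^ \<alpha> / g x ^ (\<alpha> - 1))" for x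
  proof -
    have "ennreal (g x) * (of_nat \<alpha> * (\<phi> x ^ (\<alpha> - 1) * ennreal (f x / g x))) \<le>
        ennreal (g x) * (of_nat (\<alpha> - 1) * \<phi> x ^ \<alpha> + ennreal (f x / g x) ^ \<alpha>)"
      by (intro mult_left_mono Youngs_inequality_power_ennreal) simp
    moreover have "ennreal (g x) * (ennreal (f x / g x) * a) = ennreal (f x) * a" for a
      using f_nonneg[of x] g_pos[of x] by (simp flip: ennreal_mult' mult.assoc)
    moreover have "ennreal (g x) * ennreal (f x / g x) ^ \<alpha> = ennreal (\<bar>f x\<bar> ^ \<alpha> / g x ^ (\<alpha> - 1))"
      using f_nonneg[of x] g_pos[of x] mult_power_divide_eq[of "g x" \<alpha> "f x"] \<alpha>_ge_1
      by (simp add: ennreal_power flip: ennreal_mult')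
    ultimately show ?thesis by (simp add: distrib_left mult_ac)
  qed
  have "of_nat \<alpha> * (\<integral>\<^sup>+ x. \<phi> x ^ (\<alpha> - 1) \<partial>density M f) =
      (\<integral>\<^sup>+ x. of_nat \<alpha> * (ennreal (f x) * \<phi> x ^ (\<alpha> - 1)) \<partial>M)"
    by (simp add: nn_integral_density nn_integral_cmult)
  also have "\<dots> \<le> (\<integral>\<^sup>+ x. of_nat (\<alpha> - 1) * (ennreal (g x) * \<phi> x ^ \<alpha>) +
      ennreal (\<bar>f x\<bar> ^ \<alpha> / g x ^ (\<alpha> - 1)) \<partial>M)"
    by (intro nn_integral_mono Young)
  also have "\<dots> = of_nat (\<alpha> - 1) * (\<integral>\<^sup>+ x. \<phi> x ^ \<alpha> \<partial>density M g) + power_divergence M \<alpha> f g"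
    by (simp add: nn_integral_add nn_integral_cmult nn_integral_density power_divergence_def)
  finally show "of_nat \<alpha> * (\<integral>\<^sup>+ x. \<phi> x ^ (\<alpha> - 1) \<partial>density M f) \<le>
      of_nat (\<alpha> - 1) * (\<integral>\<^sup>+ x. \<phi> x ^ \<alpha> \<partial>density M g) + ennreal K"
    using divergence_le by (meson add_left_mono order_trans)
qed simp

lemma renyi_moment_le_refl:
  assumes "prob_space P" "\<alpha> \<ge> 1"
  shows "renyi_moment_le \<alpha> P P 1"
  using renyi_moment_le_density[of "\<lambda>_. 1" P "\<lambda>_. 1" \<alpha> 1] assms
  by (simp add: power_divergence_def density_1 prob_space.emeasure_space_1)

lemma renyi_moment_le_distr:
  assumes moment_le: "renyi_moment_le \<alpha> P Q K" and f_measurable [measurable]: "f \<in> measurable P N"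
  shows "renyi_moment_le \<alpha> (distr P N f) (distr Q N f) K"
proof (rule renyi_moment_leI)
  have [measurable]: "f \<in> measurable Q N"
    using f_measurable measurable_cong_sets[OF renyi_moment_le_sets[OF moment_le] refl] by blast
  fix \<phi> :: "'b \<Rightarrow> ennreal" assume "\<phi> \<in> borel_measurable (distr P N f)"
  then have [measurable]: "\<phi> \<in> borel_measurable N" by simp
  show "of_nat \<alpha> * (\<integral>\<^sup>+ x. \<phi> x ^ (\<alpha> - 1) \<partial>distr P N f) \<le>
      of_nat (\<alpha> - 1) * (\<integral>\<^sup>+ x. \<phi> x ^ \<alpha> \<partial>distr Q N f) + ennreal K"
    using renyi_moment_leD[OF moment_le, of "\<lambda>x. \<phi> (f x)"] by (simp add: nn_integral_distr)
qed simp

lemma renyi_moment_le_rescale: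
  assumes moment_le: "renyi_moment_le \<alpha> P Q K"
    and \<phi>_measurable [measurable]: "\<phi> \<in> borel_measurable P" and \<alpha>_ge_1: "\<alpha> \<ge> 1"
    and c_power: "c ^ \<alpha> * ennreal K = (\<integral>\<^sup>+ x. \<phi> x ^ \<alpha> \<partial>Q)" and tc_le_1: "t * c \<le> 1"
  shows "t ^ (\<alpha> - 1) * (\<integral>\<^sup>+ x. \<phi> x ^ (\<alpha> - 1) \<partial>P) \<le> ennreal K"
proof -
  have [measurable]: "\<phi> \<in> borel_measurable Q"
    using \<phi>_measurable measurable_cong_sets[OF renyi_moment_le_sets[OF moment_le] refl] by blast
  have "of_nat \<alpha> * (t ^ (\<alpha> - 1) * (\<integral>\<^sup>+ x. \<phi> x ^ (\<alpha> - 1) \<partial>P)) =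
      of_nat \<alpha> * (\<integral>\<^sup>+ x. (t * \<phi> x) ^ (\<alpha> - 1) \<partial>P)"
    by (simp add: power_mult_distrib nn_integral_cmult)
  also have "\<dots> \<le> of_nat (\<alpha> - 1) * (\<integral>\<^sup>+ x. (t * \<phi> x) ^ \<alpha> \<partial>Q) + ennreal K"
    by (rule renyi_moment_leD[OF moment_le]) measurable
  also have "(\<integral>\<^sup>+ x. (t * \<phi> x) ^ \<alpha> \<partial>Q) = (t * c) ^ \<alpha> * ennreal K"
    by (simp add: power_mult_distrib nn_integral_cmult c_power[symmetric] mult.assoc)
  also have "of_nat (\<alpha> - 1) * \<dots> + ennreal K \<le> of_nat (\<alpha> - 1) * (1 * ennreal K) + ennreal K"
    using power_mono_ennreal[OF tc_le_1, of \<alpha>]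
    by (intro add_mono mult_left_mono mult_right_mono) auto
  also have "\<dots> = of_nat \<alpha> * ennreal K"
    using \<alpha>_ge_1 by (cases \<alpha>) (simp_all add: distrib_right add.commute)
  finally show ?thesis
    using \<alpha>_ge_1 by (subst (asm) ennreal_mult_le_mult_iff) auto
qed

text \<open>Optimising over the multiples of \<open>\<phi>\<close> turns Young's inequality into Hoelder's.\<close>

lemma renyi_moment_le_Hoelder:
  assumes moment_le: "renyi_moment_le \<alpha> P Q K" and \<phi>_measurable: "\<phi> \<in> borel_measurable P"
    and K_pos: "K > 0" and \<alpha>_ge_2: "\<alpha> \<ge> 2"
    and c_power: "c ^ \<alpha> * ennreal K = (\<integral>\<^sup>+ x. \<phi> x ^ \<alpha> \<partial>Q)"
  shows "(\<integral>\<^sup>+ x. \<phi> x ^ (\<alpha> - 1) \<partial>P) \<le> ennreal K * c ^ (\<alpha> - 1)"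
proof -
  note rescale = renyi_moment_le_rescale[OF moment_le \<phi>_measurable _ c_power]
  consider (infinite) "c = top" | (zero) "c = 0" | (positive) "c \<noteq> 0" "c < top"
    by (metis less_top)
  then show ?thesis
  proof cases
    case infinite
    then show ?thesis using K_pos \<alpha>_ge_2 by (simp add: ennreal_mult_top)
  next
    case zero
    then have "top ^ (\<alpha> - 1) * (\<integral>\<^sup>+ x. \<phi> x ^ (\<alpha> - 1) \<partial>P) \<le> ennreal K"
      using \<alpha>_ge_2 by (intro rescale) auto
    then have "top * (\<integral>\<^sup>+ x. \<phi> x ^ (\<alpha> - 1) \<partial>P) \<noteq> top"
      using \<alpha>_ge_2 by (auto simp: top_unique)
    then show ?thesis by (auto simp: ennreal_top_mult split: if_splits)
  next
    case positive
    then have inverse: "inverse c * c = 1"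
      using ennreal_divide_self[of c] by (simp add: divide_ennreal_def mult.commute)
    then have "inverse c ^ (\<alpha> - 1) * c ^ (\<alpha> - 1) = 1"
      by (simp flip: power_mult_distrib)
    then have "(\<integral>\<^sup>+ x. \<phi> x ^ (\<alpha> - 1) \<partial>P) =
        inverse c ^ (\<alpha> - 1) * c ^ (\<alpha> - 1) * (\<integral>\<^sup>+ x. \<phi> x ^ (\<alpha> - 1) \<partial>P)"
      by simp
    also have "\<dots> = inverse c ^ (\<alpha> - 1) * (\<integral>\<^sup>+ x. \<phi> x ^ (\<alpha> - 1) \<partial>P) * c ^ (\<alpha> - 1)"
      by (simp only: mult_ac)
    also have "\<dots> \<le> ennreal K * c ^ (\<alpha> - 1)"
      using inverse \<alpha>_ge_2 by (intro mult_right_mono rescale) auto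
    finally show ?thesis .
  qed
qed

definition ennreal_root :: "nat \<Rightarrow> ennreal \<Rightarrow> ennreal" where
  "ennreal_root n x = (if x = top then top else ennreal (root n (enn2real x)))"

lemma ennreal_root_power: "n > 0 \<Longrightarrow> ennreal_root n x ^ n = x"
  by (simp add: ennreal_root_def ennreal_power real_root_pow_pos2 less_top)

lemma borel_measurable_ennreal_root [measurable]: "ennreal_root n \<in> borel_measurable borel"
  unfolding ennreal_root_def by measurable

lemma renyi_moment_le_kernel_Hoelder:
  assumes p_kernel: "p \<in> measurable M (subprob_algebra N)"
    and q_kernel: "q \<in> measurable M (subprob_algebra N)"
    and kernels_le: "\<And>s. s \<in> space M \<Longrightarrow> renyi_moment_le \<alpha> (p s) (q s) L"
    and L_pos: "L > 0" and \<alpha>_ge_2: "\<alpha> \<ge> 2" and \<phi>_measurable [measurable]: "\<phi> \<in> borel_measurable N"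
  obtains c where "c \<in> borel_measurable M" "\<And>s. c s ^ \<alpha> * ennreal L = (\<integral>\<^sup>+ x. \<phi> x ^ \<alpha> \<partial>q s)"
    "\<And>s. s \<in> space M \<Longrightarrow> (\<integral>\<^sup>+ x. \<phi> x ^ (\<alpha> - 1) \<partial>p s) \<le> ennreal L * c s ^ (\<alpha> - 1)"
proof
  define c where "c s = ennreal_root \<alpha> ((\<integral>\<^sup>+ x. \<phi> x ^ \<alpha> \<partial>q s) / ennreal L)" for s
  show "c \<in> borel_measurable M"
    unfolding c_def using q_kernel by measurable
  show c_power: "c s ^ \<alpha> * ennreal L = (\<integral>\<^sup>+ x. \<phi> x ^ \<alpha> \<partial>q s)" for s
    using L_pos \<alpha>_ge_2 by (simp add: c_def ennreal_root_power ennreal_divide_times divide_mult_eq)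
  fix s assume s_space: "s \<in> space M"
  have "\<phi> \<in> borel_measurable (p s)"
    unfolding measurable_cong_sets[OF sets_kernel[OF p_kernel s_space] refl] by (rule \<phi>_measurable)
  then show "(\<integral>\<^sup>+ x. \<phi> x ^ (\<alpha> - 1) \<partial>p s) \<le> ennreal L * c s ^ (\<alpha> - 1)"
    by (rule renyi_moment_le_Hoelder[OF kernels_le[OF s_space] _ L_pos \<alpha>_ge_2 c_power])
qed

lemma renyi_moment_le_bind:
  assumes moment_le: "renyi_moment_le \<alpha> P Q K" and nonempty: "space P \<noteq> {}"
    and p_kernel: "p \<in> measurable P (subprob_algebra N)"
    and q_kernel: "q \<in> measurable P (subprob_algebra N)"
    and kernels_le: "\<And>s. s \<in> space P \<Longrightarrow> renyi_moment_le \<alpha> (p s) (q s) L"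
    and L_pos: "L > 0" and \<alpha>_ge_2: "\<alpha> \<ge> 2"
  shows "renyi_moment_le \<alpha> (P \<bind> p) (Q \<bind> q) (K * L)"
proof (rule renyi_moment_leI)
  have sets: "sets P = sets Q" by (rule renyi_moment_le_sets[OF moment_le])
  note space = sets_eq_imp_space_eq[OF sets]
  have q_Q: "q \<in> measurable Q (subprob_algebra N)"
    using q_kernel measurable_cong_sets[OF sets refl] by blast
  have sets_bind: "sets (P \<bind> p) = sets N" "sets (Q \<bind> q) = sets N"
    using nonempty space by (auto intro!: sets_bind sets_kernel[OF p_kernel] sets_kernel[OF q_Q])
  then show "sets (P \<bind> p) = sets (Q \<bind> q)" by simp
  fix \<phi> :: "'b \<Rightarrow> ennreal" assume "\<phi> \<in> borel_measurable (P \<bind> p)"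
  then have \<phi>_measurable [measurable]: "\<phi> \<in> borel_measurable N"
    using measurable_cong_sets[OF sets_bind(1) refl] by blast
  obtain c where c_P [measurable]: "c \<in> borel_measurable P"
    and c_power: "\<And>s. c s ^ \<alpha> * ennreal L = (\<integral>\<^sup>+ x. \<phi> x ^ \<alpha> \<partial>q s)"
    and kernel_le: "\<And>s. s \<in> space P \<Longrightarrow> (\<integral>\<^sup>+ x. \<phi> x ^ (\<alpha> - 1) \<partial>p s) \<le> ennreal L * c s ^ (\<alpha> - 1)"
    using renyi_moment_le_kernel_Hoelder[OF p_kernel q_kernel kernels_le L_pos \<alpha>_ge_2 \<phi>_measurable]
    by blast
  have [measurable]: "c \<in> borel_measurable Q"
    using c_P measurable_cong_sets[OF sets refl] by blast
  have "of_nat \<alpha> * (\<integral>\<^sup>+ x. \<phi> x ^ (\<alpha> - 1) \<partial>(P \<bind> p)) =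
      of_nat \<alpha> * (\<integral>\<^sup>+ s. \<integral>\<^sup>+ x. \<phi> x ^ (\<alpha> - 1) \<partial>p s \<partial>P)"
    by (subst nn_integral_bind[OF _ p_kernel]) measurable
  also have "\<dots> \<le> of_nat \<alpha> * (\<integral>\<^sup>+ s. ennreal L * c s ^ (\<alpha> - 1) \<partial>P)"
    by (intro mult_left_mono nn_integral_mono kernel_le) auto
  also have "\<dots> = ennreal L * (of_nat \<alpha> * (\<integral>\<^sup>+ s. c s ^ (\<alpha> - 1) \<partial>P))"
    by (simp add: nn_integral_cmult mult_ac)
  also have "\<dots> \<le> ennreal L * (of_nat (\<alpha> - 1) * (\<integral>\<^sup>+ s. c s ^ \<alpha> \<partial>Q) + ennreal K)"
    by (intro mult_left_mono renyi_moment_leD[OF moment_le c_P]) auto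
  also have "\<dots> = of_nat (\<alpha> - 1) * (\<integral>\<^sup>+ s. c s ^ \<alpha> * ennreal L \<partial>Q) + ennreal (K * L)"
    using L_pos by (simp add: nn_integral_cmult distrib_left ennreal_mult'' mult_ac)
  also have "(\<integral>\<^sup>+ s. c s ^ \<alpha> * ennreal L \<partial>Q) = (\<integral>\<^sup>+ x. \<phi> x ^ \<alpha> \<partial>(Q \<bind> q))"
    unfolding c_power by (rule nn_integral_bind[OF _ q_Q, symmetric]) measurable
  finally show "of_nat \<alpha> * (\<integral>\<^sup>+ x. \<phi> x ^ (\<alpha> - 1) \<partial>(P \<bind> p)) \<le>
      of_nat (\<alpha> - 1) * (\<integral>\<^sup>+ x. \<phi> x ^ \<alpha> \<partial>(Q \<bind> q)) + ennreal (K * L)" .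
qed

lemma absolutely_continuous_if_renyi_moment_le:
  assumes moment_le: "renyi_moment_le \<alpha> P Q K" and \<alpha>_ge_2: "\<alpha> \<ge> 2"
  shows "absolutely_continuous Q P"
  unfolding absolutely_continuous_def
proof
  fix A assume A_null: "A \<in> null_sets Q"
  have sets: "sets P = sets Q" by (rule renyi_moment_le_sets[OF moment_le])
  have [measurable]: "A \<in> sets P" "A \<in> sets Q" using A_null sets by auto
  have power_top: "(top * indicator A x :: ennreal) ^ k = top * indicator A x" if "k > 0" for k x
    using that by (simp add: indicator_def)
  have "of_nat \<alpha> * (\<integral>\<^sup>+ x. (top * indicator A x) ^ (\<alpha> - 1) \<partial>P) \<le>
      of_nat (\<alpha> - 1) * (\<integral>\<^sup>+ x. (top * indicator A x) ^ \<alpha> \<partial>Q) + ennreal K"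
    by (rule renyi_moment_leD[OF moment_le]) measurable
  then have "of_nat \<alpha> * (top * emeasure P A) \<le> ennreal K"
    using \<alpha>_ge_2 A_null by (simp add: power_top nn_integral_cmult_indicator null_setsD1)
  then have "emeasure P A = 0"
    using \<alpha>_ge_2 by (cases "emeasure P A = 0") (auto simp: top_unique ennreal_top_mult
        ennreal_mult_top)
  then show "A \<in> null_sets P" by auto
qed

lemma tendsto_power_ennreal:
  fixes f :: "'a \<Rightarrow> ennreal"
  assumes "(f \<longlongrightarrow> x) F"
  shows "((\<lambda>z. f z ^ n) \<longlongrightarrow> x ^ n) F"
proof (induction n)
  case (Suc n)
  then show ?case
    using assms unfolding power_Suc
    by (intro tendsto_mult_ennreal) (auto simp: power_0_left power_eq_top_ennreal split: if_splits)
qed simp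

lemma nn_integral_power_le_if_le_RN_deriv:
  assumes Q_sigma_finite: "sigma_finite_measure Q"
    and moment_le: "renyi_moment_le \<alpha> P Q K" and \<alpha>_ge_2: "\<alpha> \<ge> 2"
    and R_Q [measurable]: "R \<in> borel_measurable Q" and R_le: "\<And>x. R x \<le> RN_deriv Q P x"
    and finite: "(\<integral>\<^sup>+ x. R x ^ \<alpha> \<partial>Q) \<noteq> top"
  shows "(\<integral>\<^sup>+ x. R x ^ \<alpha> \<partial>Q) \<le> ennreal K"
proof -
  interpret sigma_finite_measure Q by fact
  have sets: "sets P = sets Q" by (rule renyi_moment_le_sets[OF moment_le])
  have density: "density Q (RN_deriv Q P) = P"
    by (rule density_RN_deriv[OF absolutely_continuous_if_renyi_moment_le[OF moment_le \<alpha>_ge_2] sets])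
  have R_P: "R \<in> borel_measurable P"
    unfolding measurable_cong_sets[OF sets refl] by (rule R_Q)
  have \<alpha>_Suc: "\<alpha> = Suc (\<alpha> - 1)" using \<alpha>_ge_2 by simp
  have "(\<integral>\<^sup>+ x. R x ^ \<alpha> \<partial>Q) \<le> (\<integral>\<^sup>+ x. RN_deriv Q P x * R x ^ (\<alpha> - 1) \<partial>Q)"
    by (subst \<alpha>_Suc, unfold power_Suc) (intro nn_integral_mono mult_right_mono R_le zero_le)
  also have "\<dots> = (\<integral>\<^sup>+ x. R x ^ (\<alpha> - 1) \<partial>P)"
    by (subst (2) density[symmetric], rule nn_integral_density[symmetric]) measurable
  finally have "of_nat \<alpha> * (\<integral>\<^sup>+ x. R x ^ \<alpha> \<partial>Q) \<le> of_nat \<alpha> * (\<integral>\<^sup>+ x. R x ^ (\<alpha> - 1) \<partial>P)"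
    by (intro mult_left_mono) auto
  also have "\<dots> \<le> of_nat (\<alpha> - 1) * (\<integral>\<^sup>+ x. R x ^ \<alpha> \<partial>Q) + ennreal K"
    by (rule renyi_moment_leD[OF moment_le R_P])
  also have "of_nat \<alpha> * (\<integral>\<^sup>+ x. R x ^ \<alpha> \<partial>Q) =
      of_nat (\<alpha> - 1) * (\<integral>\<^sup>+ x. R x ^ \<alpha> \<partial>Q) + (\<integral>\<^sup>+ x. R x ^ \<alpha> \<partial>Q)"
    using \<alpha>_ge_2 by (cases \<alpha>) (simp_all add: distrib_right add.commute)
  finally show ?thesis
    using finite by (simp add: ennreal_add_left_cancel_le ennreal_mult_eq_top_iff)
qed

lemma nn_integral_RN_deriv_power_le:
  assumes Q_finite: "finite_measure Q" and moment_le: "renyi_moment_le \<alpha> P Q K" and \<alpha>_ge_2: "\<alpha> \<ge> 2"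
  shows "(\<integral>\<^sup>+ x. RN_deriv Q P x ^ \<alpha> \<partial>Q) \<le> ennreal K"
proof -
  interpret finite_measure Q by fact
  define R where "R n x = min (RN_deriv Q P x) (of_nat n)" for n :: nat and x
  have [measurable]: "R n \<in> borel_measurable Q" for n unfolding R_def by measurable
  have truncated: "(\<integral>\<^sup>+ x. R n x ^ \<alpha> \<partial>Q) \<le> ennreal K" for n
  proof (rule nn_integral_power_le_if_le_RN_deriv[OF sigma_finite_measure_axioms moment_le \<alpha>_ge_2])
    have "(\<integral>\<^sup>+ x. R n x ^ \<alpha> \<partial>Q) \<le> (\<integral>\<^sup>+ x. of_nat n ^ \<alpha> \<partial>Q)"
      by (intro nn_integral_mono power_mono_ennreal) (simp add: R_def)
    also have "\<dots> < top"
      by (simp add: ennreal_mult_eq_top_iff power_eq_top_ennreal flip: less_top)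
    finally show "(\<integral>\<^sup>+ x. R n x ^ \<alpha> \<partial>Q) \<noteq> top" by simp
  qed (simp_all add: R_def)
  have "(\<lambda>n. \<integral>\<^sup>+ x. R n x ^ \<alpha> \<partial>Q) \<longlonglongrightarrow> (\<integral>\<^sup>+ x. RN_deriv Q P x ^ \<alpha> \<partial>Q)"
  proof (rule nn_integral_LIMSEQ)
    show "incseq (\<lambda>n x. R n x ^ \<alpha>)"
      by (auto simp: R_def intro!: incseq_SucI le_funI power_mono_ennreal min.mono)
    fix x
    have "(\<lambda>n. R n x) \<longlonglongrightarrow> min (RN_deriv Q P x) top"
      unfolding R_def by (intro tendsto_min tendsto_const of_nat_tendsto_top_ennreal)
    then show "(\<lambda>n. R n x ^ \<alpha>) \<longlonglongrightarrow> RN_deriv Q P x ^ \<alpha>"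
      by (intro tendsto_power_ennreal) simp
  qed measurable
  then show ?thesis
    by (rule LIMSEQ_le_const2) (use truncated in auto)
qed

lemma renyi_divergence_le_if_renyi_moment_le:
  assumes Q_prob: "prob_space Q" and moment_le: "renyi_moment_le \<alpha> P Q K"
    and \<alpha>_ge_2: "\<alpha> \<ge> 2" and K_ge_1: "K \<ge> 1"
  shows "renyi_divergence (real \<alpha>) P Q \<le> ereal (ln K / (real \<alpha> - 1))"
proof -
  define I where "I = (\<integral>\<^sup>+ x. ennreal (enn2real (RN_deriv Q P x) powr real \<alpha>) \<partial>Q)"
  have "ennreal (enn2real (RN_deriv Q P x) powr real \<alpha>) \<le> RN_deriv Q P x ^ \<alpha>" for x
    using \<alpha>_ge_2 by (cases "RN_deriv Q P x") (auto simp: powr_realpow' ennreal_power top_power_ennreal)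
  then have "I \<le> (\<integral>\<^sup>+ x. RN_deriv Q P x ^ \<alpha> \<partial>Q)"
    unfolding I_def by (rule nn_integral_mono)
  also have "\<dots> \<le> ennreal K"
    by (intro nn_integral_RN_deriv_power_le prob_space.finite_measure Q_prob moment_le \<alpha>_ge_2)
  finally have I_le: "I \<le> ennreal K" .
  then obtain r where I_eq: "I = ennreal r" "0 \<le> r" by (cases I) (auto simp: top_unique)
  have "ln r \<le> ln K"
    using I_le I_eq K_ge_1 by (cases "r = 0") auto
  then have "ln r / (real \<alpha> - 1) \<le> ln K / (real \<alpha> - 1)"
    using \<alpha>_ge_2 by (intro divide_right_mono) auto
  then show ?thesis
    using absolutely_continuous_if_renyi_moment_le[OF moment_le \<alpha>_ge_2]
      renyi_moment_le_sets[OF moment_le] I_eq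
    by (simp add: renyi_divergence_def Let_def flip: I_def)
qed

section \<open>Iterations driven by independent noise\<close>

fun noisy_iterate :: "(nat \<Rightarrow> 'w \<Rightarrow> 's \<Rightarrow> 's) \<Rightarrow> 's \<Rightarrow> (nat \<Rightarrow> 'w) \<Rightarrow> nat \<Rightarrow> 's" where
  "noisy_iterate f s \<omega> 0 = s"
| "noisy_iterate f s \<omega> (Suc t) = f t (\<omega> t) (noisy_iterate f s \<omega> t)"

lemma noisy_iterate_fun_upd: "t \<le> t' \<Longrightarrow> noisy_iterate f s (fun_upd \<omega> t' w) t = noisy_iterate f s \<omega> t"
  by (induction t) auto

lemma measurable_noisy_iterate:
  assumes f_measurable: "\<And>t. (\<lambda>(w, s). f t w s) \<in> measurable (M \<Otimes>\<^sub>M S) S"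
    and s_space: "s \<in> space S" and times_subset: "{..<t} \<subseteq> I"
  shows "(\<lambda>\<omega>. noisy_iterate f s \<omega> t) \<in> measurable (\<Pi>\<^sub>M i\<in>I. M) S"
  using times_subset
proof (induction t)
  case 0
  then show ?case using s_space by simp
next
  case (Suc t)
  then have [measurable]: "(\<lambda>\<omega>. \<omega> t) \<in> measurable (\<Pi>\<^sub>M i\<in>I. M) M"
      "(\<lambda>\<omega>. noisy_iterate f s \<omega> t) \<in> measurable (\<Pi>\<^sub>M i\<in>I. M) S"
    by (auto simp: lessThan_Suc)
  have "(\<lambda>\<omega>. (\<lambda>(w, s). f t w s) (\<omega> t, noisy_iterate f s \<omega> t)) \<in> measurable (\<Pi>\<^sub>M i\<in>I. M) S"
    by (rule measurable_compose[OF _ f_measurable]) measurable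
  then show ?case by simp
qed

lemma measurable_distr_parameter:
  assumes M_prob: "prob_space M" and f_measurable: "(\<lambda>(w, s). f w s) \<in> measurable (M \<Otimes>\<^sub>M S) N"
  shows "(\<lambda>s. distr M N (\<lambda>w. f w s)) \<in> measurable S (subprob_algebra N)"
proof (rule measurable_distr2)
  show "(\<lambda>(s, w). f w s) \<in> measurable (S \<Otimes>\<^sub>M M) N"
    using measurable_compose[OF measurable_pair_swap' f_measurable] by (simp add: case_prod_unfold)
  show "(\<lambda>s. M) \<in> measurable S (subprob_algebra M)"
    using prob_space.M_in_subprob[OF M_prob] by simp
qed

lemma distr_pair_measure_eq_bind:
  assumes M_prob: "prob_space M" and L_prob: "prob_space L"
    and g_measurable [measurable]: "(\<lambda>(x, y). g x y) \<in> measurable (M \<Otimes>\<^sub>M L) N"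
  shows "distr (M \<Otimes>\<^sub>M L) N (\<lambda>(x, y). g x y) = L \<bind> (\<lambda>y. distr M N (\<lambda>x. g x y))"
proof -
  interpret M: prob_space M by fact
  interpret L: prob_space L by fact
  interpret pair: pair_prob_space M L ..
  note kernel = measurable_distr_parameter[OF M_prob g_measurable]
  show ?thesis
  proof (rule measure_eqI)
    show "sets (distr (M \<Otimes>\<^sub>M L) N (\<lambda>(x, y). g x y)) = sets (L \<bind> (\<lambda>y. distr M N (\<lambda>x. g x y)))"
      by (simp add: sets_bind[OF _ L.not_empty, where N = N])
    fix A assume "A \<in> sets (distr (M \<Otimes>\<^sub>M L) N (\<lambda>(x, y). g x y))"
    then have A_sets [measurable]: "A \<in> sets N" by simp
    show "emeasure (distr (M \<Otimes>\<^sub>M L) N (\<lambda>(x, y). g x y)) A =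
        emeasure (L \<bind> (\<lambda>y. distr M N (\<lambda>x. g x y))) A"
      by (subst emeasure_bind[OF L.not_empty kernel A_sets])
         (auto simp: emeasure_distr pair.emeasure_pair_measure_alt2 space_pair_measure
           intro!: nn_integral_cong arg_cong2[where f = emeasure])
  qed
qed

definition noisy_iterate_law ::
    "'w measure \<Rightarrow> 's measure \<Rightarrow> (nat \<Rightarrow> 'w \<Rightarrow> 's \<Rightarrow> 's) \<Rightarrow> 's \<Rightarrow> nat \<Rightarrow> 's measure" where
  "noisy_iterate_law M S f s t = distr (\<Pi>\<^sub>M i\<in>{..<t}. M) S (\<lambda>\<omega>. noisy_iterate f s \<omega> t)"

lemma space_noisy_iterate_law [simp]: "space (noisy_iterate_law M S f s t) = space S"
  by (simp add: noisy_iterate_law_def)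

lemma measurable_noisy_iterate_law [simp]:
  "measurable (noisy_iterate_law M S f s t) N = measurable S N"
  by (simp add: noisy_iterate_law_def)

context
  fixes M :: "'w measure" and S :: "'s measure" and s0 :: 's
  assumes M_prob: "prob_space M" and s0_space: "s0 \<in> space S"
begin

lemma prob_space_noisy_iterate_law:
  assumes "\<And>t. (\<lambda>(w, s). f t w s) \<in> measurable (M \<Otimes>\<^sub>M S) S"
  shows "prob_space (noisy_iterate_law M S f s0 t)"
  unfolding noisy_iterate_law_def
  by (intro prob_space.prob_space_distr prob_space_PiM M_prob measurable_noisy_iterate assms s0_space
      order_refl)

lemma noisy_iterate_law_Suc:
  assumes f_measurable [measurable]: "\<And>t. (\<lambda>(w, s). f t w s) \<in> measurable (M \<Otimes>\<^sub>M S) S"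
  shows "noisy_iterate_law M S f s0 (Suc t) =
    noisy_iterate_law M S f s0 t \<bind> (\<lambda>s. distr M S (\<lambda>w. f t w s))"
proof -
  let ?\<Pi> = "\<lambda>t. \<Pi>\<^sub>M i\<in>{..<t}. M"
  have prob_\<Pi>: "prob_space (?\<Pi> t)" for t by (intro prob_space_PiM M_prob)
  have \<Pi>_Suc: "?\<Pi> (Suc t) = distr (M \<Otimes>\<^sub>M ?\<Pi> t) (?\<Pi> (Suc t)) (\<lambda>(w, \<omega>). fun_upd \<omega> t w)"
    using distr_pair_PiM_eq_PiM[of "{..<t}" "\<lambda>_. M" t] M_prob by (simp add: lessThan_Suc)
  have iterate [measurable]: "(\<lambda>\<omega>. noisy_iterate f s0 \<omega> t) \<in> measurable (?\<Pi> t) S"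
      "(\<lambda>\<omega>. noisy_iterate f s0 \<omega> (Suc t)) \<in> measurable (?\<Pi> (Suc t)) S"
    by (intro measurable_noisy_iterate f_measurable s0_space order_refl)+
  have upd: "(\<lambda>(w, \<omega>). fun_upd \<omega> t w) \<in> measurable (M \<Otimes>\<^sub>M ?\<Pi> t) (?\<Pi> (Suc t))"
    unfolding lessThan_Suc case_prod_unfold by measurable
  have "noisy_iterate_law M S f s0 (Suc t) =
      distr (M \<Otimes>\<^sub>M ?\<Pi> t) S (\<lambda>(w, \<omega>). f t w (noisy_iterate f s0 \<omega> t))"
    unfolding noisy_iterate_law_def
    by (subst \<Pi>_Suc, subst distr_distr[OF iterate(2) upd])
       (simp add: comp_def case_prod_unfold noisy_iterate_fun_upd)
  also have "\<dots> = ?\<Pi> t \<bind> (\<lambda>\<omega>. distr M S (\<lambda>w. f t w (noisy_iterate f s0 \<omega> t)))"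
    by (intro distr_pair_measure_eq_bind M_prob prob_\<Pi>) measurable
  also have "\<dots> = noisy_iterate_law M S f s0 t \<bind> (\<lambda>s. distr M S (\<lambda>w. f t w s))"
    unfolding noisy_iterate_law_def
    by (rule bind_distr[OF iterate(1) measurable_distr_parameter[OF M_prob f_measurable]
        prob_space.not_empty[OF prob_\<Pi>], symmetric])
  finally show ?thesis .
qed

lemma renyi_moment_le_noisy_iterate_law:
  assumes f_measurable [measurable]: "\<And>t. (\<lambda>(w, s). f t w s) \<in> measurable (M \<Otimes>\<^sub>M S) S"
    and g_measurable [measurable]: "\<And>t. (\<lambda>(w, s). g t w s) \<in> measurable (M \<Otimes>\<^sub>M S) S"
    and step: "\<And>t s. s \<in> space S \<Longrightarrow>
      renyi_moment_le \<alpha> (distr M S (\<lambda>w. f t w s)) (distr M S (\<lambda>w. g t w s)) (K t)"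
    and K_pos: "\<And>t. K t > 0" and \<alpha>_ge_2: "\<alpha> \<ge> 2"
  shows "renyi_moment_le \<alpha> (noisy_iterate_law M S f s0 t) (noisy_iterate_law M S g s0 t) (\<Prod>i<t. K i)"
proof (induction t)
  case 0
  have "noisy_iterate_law M S g s0 0 = noisy_iterate_law M S f s0 0"
    by (simp add: noisy_iterate_law_def)
  then show ?case
    using \<alpha>_ge_2 by (simp add: renyi_moment_le_refl prob_space_noisy_iterate_law f_measurable)
next
  case (Suc t)
  show ?case
    unfolding noisy_iterate_law_Suc[OF f_measurable] noisy_iterate_law_Suc[OF g_measurable]
      prod.lessThan_Suc
    using s0_space
    by (intro renyi_moment_le_bind[OF Suc] step K_pos \<alpha>_ge_2)
       (auto intro!: measurable_distr_parameter M_prob f_measurable g_measurable)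
qed

end

section \<open>The algorithm\<close>

type_synonym 'p admm_state = "(real ^ 'p) \<times> (real ^ 'p) \<times> (real ^ 'p)"

lemma borel_measurable_fst:
  "fst \<in> borel_measurable (borel :: ('a :: topological_space \<times> 'b :: topological_space) measure)"
  by (intro borel_measurable_continuous_onI continuous_intros)

lemma continuous_on_soft_threshold:
  fixes f :: "'a :: topological_space \<Rightarrow> real ^ 'p"
  assumes "continuous_on S f" "t \<ge> 0"
  shows "continuous_on S (\<lambda>x. soft_threshold t (f x))"
proof -
  have "soft_threshold t w = (\<chi> i. max (w $ i - t) 0 + min (w $ i + t) 0)" for w :: "real ^ 'p"
    using assms(2) by (auto simp: soft_threshold_def vec_eq_iff)
  then show ?thesis using assms(1) by (auto intro!: continuous_intros)
qed

definition admm_update ::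
    "real \<Rightarrow> real \<Rightarrow> real \<Rightarrow> 'p admm_state \<Rightarrow> real ^ 'p \<Rightarrow> 'p admm_state" where
  "admm_update lam \<rho> \<eta>k s g =
    (let x' = (1 / (\<rho> + 1 / \<eta>k)) *\<^sub>R (- g - snd (snd s) + \<rho> *\<^sub>R fst (snd s) + (1 / \<eta>k) *\<^sub>R fst s);
         z' = soft_threshold (lam / \<rho>) (x' + (1 / \<rho>) *\<^sub>R snd (snd s))
     in (x', z', snd (snd s) + \<rho> *\<^sub>R (x' - z')))"

definition batch_gradient ::
    "(real ^ 'p \<Rightarrow> 'd \<Rightarrow> real ^ 'p) \<Rightarrow> nat \<Rightarrow> 'd list \<Rightarrow> real ^ 'p \<Rightarrow> nat set \<Rightarrow> real ^ 'p" where
  "batch_gradient grad m D x B = (1 / real m) *\<^sub>R (\<Sum>i\<in>B. grad x (D ! i))"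

lemma ssadmm_step_eq_admm_update:
  "ssadmm_step D grad m lam \<rho> \<eta>k B \<gamma> s =
    admm_update lam \<rho> \<eta>k s (batch_gradient grad m D (fst s) B + \<gamma>)"
  by (cases s) (simp add: ssadmm_step_def admm_update_def batch_gradient_def Let_def)

lemma borel_measurable_admm_update:
  fixes f :: "'a \<Rightarrow> ('p :: finite) admm_state"
  assumes "lam \<ge> 0" "\<rho> \<ge> 0" and [measurable]: "f \<in> borel_measurable M" "g \<in> borel_measurable M"
  shows "(\<lambda>x. admm_update lam \<rho> \<eta>k (f x) (g x)) \<in> borel_measurable M"
proof -
  have "continuous_on UNIV (\<lambda>p. admm_update lam \<rho> \<eta>k (fst p) (snd p :: real ^ 'p))"
    unfolding admm_update_def Let_def using assms(1,2)
    by (intro continuous_intros continuous_on_soft_threshold) auto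
  from borel_measurable_continuous_onI[OF this]
  have "(\<lambda>x. (\<lambda>p. admm_update lam \<rho> \<eta>k (fst p) (snd p)) (f x, g x)) \<in> borel_measurable M"
    by (rule measurable_compose[rotated]) measurable
  then show ?thesis by simp
qed

text \<open>\<open>nat set\<close> is uncountable, so a function of a batch is measurable jointly with other arguments
  only because the gradient vanishes outside the countably many finite batches.\<close>

lemma borel_measurable_batch_gradient:
  assumes cont: "\<And>d. continuous_on UNIV (\<lambda>x. grad x d)"
    and b_measurable [measurable]: "b \<in> measurable M (count_space UNIV)"
    and f_measurable [measurable]: "f \<in> borel_measurable M"
  shows "(\<lambda>x. batch_gradient grad m D (f x) (b x)) \<in> borel_measurable M"
proof -
  have [measurable]: "(\<lambda>x. grad (f x) d) \<in> borel_measurable M" for d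
    by (rule measurable_compose[OF f_measurable borel_measurable_continuous_onI[OF cont]])
  have "(\<lambda>B :: nat set. if finite B then B else {}) \<in>
      measurable (count_space UNIV) (count_space {B. finite B})"
    by (auto simp: measurable_count_space_eq1)
  from measurable_compose[OF b_measurable this]
  have "(\<lambda>x. batch_gradient grad m D (f x) (if finite (b x) then b x else {})) \<in> borel_measurable M"
    by (rule measurable_compose_countable'[rotated])
       (auto simp: batch_gradient_def intro: countable_Collect_finite)
  moreover have "batch_gradient grad m D x (if finite B then B else {}) =
      batch_gradient grad m D x B" for x B
    by (simp add: batch_gradient_def)
  ultimately show ?thesis by simp
qed

lemma norm_batch_gradient_diff_le:
  assumes bound: "\<And>x d. norm (grad x d) \<le> C" and finite: "finite B"
    and i_mem: "i \<in> B" and l_notin: "l \<notin> B - {i}"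
    and agree: "\<And>j. j \<in> B \<Longrightarrow> j \<noteq> i \<Longrightarrow> D ! j = D' ! j"
  shows "norm (batch_gradient grad m D x B - batch_gradient grad m D' x (insert l (B - {i})))
    \<le> 2 * C / real m"
proof -
  have "(\<Sum>j\<in>B. grad x (D ! j)) = grad x (D ! i) + (\<Sum>j\<in>B - {i}. grad x (D' ! j))"
    using finite i_mem agree by (simp add: sum.remove)
  moreover have "(\<Sum>j\<in>insert l (B - {i}). grad x (D' ! j)) =
      grad x (D' ! l) + (\<Sum>j\<in>B - {i}. grad x (D' ! j))"
    using finite l_notin by (intro sum.insert) auto
  ultimately have "batch_gradient grad m D x B - batch_gradient grad m D' x (insert l (B - {i})) =
      (1 / real m) *\<^sub>R (grad x (D ! i) - grad x (D' ! l))"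
    unfolding batch_gradient_def by (simp only: algebra_simps)
  also have "norm \<dots> = norm (grad x (D ! i) - grad x (D' ! l)) / real m"
    by simp
  also have "\<dots> \<le> (C + C) / real m"
    by (intro divide_right_mono norm_triangle_le_diff add_mono bound) auto
  finally show ?thesis by simp
qed

lemma norm_batch_gradient_swap_index_le:
  assumes "\<And>x d. norm (grad x d) \<le> C" "finite B" "i \<in> B" "\<And>j. j \<in> B \<Longrightarrow> j \<noteq> i \<Longrightarrow> D ! j = D' ! j"
  shows "norm (batch_gradient grad m D x B - batch_gradient grad m D' x (swap_index i B l))
    \<le> 2 * C / real m"
proof -
  define l' where "l' = (if l \<in> B then i else l)"
  have "swap_index i B l = insert l' (B - {i})" "l' \<notin> B - {i}"
    using assms(3) by (auto simp: swap_index_def l'_def)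
  then show ?thesis
    using norm_batch_gradient_diff_le[of grad C B i l' D D'] assms by auto
qed

lemma gaussian_vec_eq_density_gauss_density:
  "gaussian_vec \<sigma> = density lborel (\<lambda>g. ennreal (gauss_density \<sigma> (0 :: real ^ 'p) g))"
proof -
  have Basis: "(Basis :: (real ^ 'p) set) = (\<lambda>i. axis i 1) ` UNIV"
    by (auto simp: Basis_vec_def)
  have inj: "inj (\<lambda>i :: 'p. axis i (1 :: real))"
    by (auto simp: inj_on_def axis_eq_axis)
  show ?thesis
    by (simp add: gaussian_vec_def gauss_density_eq_prod_normal_density Basis prod.reindex[OF inj]
        inner_axis)
qed

lemma sets_gaussian_vec [measurable_cong, simp]: "sets (gaussian_vec \<sigma>) = sets borel"
  by (simp add: gaussian_vec_def)

lemma prob_space_gaussian_vec: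
  assumes "\<sigma> > 0"
  shows "prob_space (gaussian_vec \<sigma> :: (real ^ 'p) measure)"
proof
  show "emeasure (gaussian_vec \<sigma> :: (real ^ 'p) measure) (space (gaussian_vec \<sigma>)) = 1"
    using assms
    by (simp add: gaussian_vec_eq_density_gauss_density emeasure_density nn_integral_gauss_density)
qed

lemma distr_gaussian_vec_plus:
  "distr (gaussian_vec \<sigma>) borel ((+) u) = density lborel (gauss_density \<sigma> (u :: real ^ 'p))"
  using distr_gauss_density_plus[of \<sigma> 0 u] by (simp add: gaussian_vec_eq_density_gauss_density)

definition batch_noise :: "nat \<Rightarrow> nat \<Rightarrow> real \<Rightarrow> (nat set \<times> (real ^ 'p)) measure" where
  "batch_noise n m \<sigma> = measure_pmf (pmf_of_set (batches n m)) \<Otimes>\<^sub>M gaussian_vec \<sigma>"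

lemma sets_batch_noise [measurable_cong]:
  "sets (batch_noise n m \<sigma>) = sets (count_space UNIV \<Otimes>\<^sub>M borel)"
  unfolding batch_noise_def by (intro sets_pair_measure_cong) auto

lemma prob_space_batch_noise:
  assumes "\<sigma> > 0"
  shows "prob_space (batch_noise n m \<sigma> :: (nat set \<times> (real ^ 'p)) measure)"
  unfolding batch_noise_def
  by (intro prob_space_pair prob_space_measure_pmf prob_space_gaussian_vec assms)

lemma distr_batch_noise_plus:
  fixes u :: "nat set \<Rightarrow> real ^ 'p"
  assumes \<sigma>_pos: "\<sigma> > 0" and m_le: "m \<le> n"
    and u_noise: "(\<lambda>\<omega>. u (fst \<omega>) + snd \<omega>) \<in> borel_measurable (batch_noise n m \<sigma>)"
  shows "distr (batch_noise n m \<sigma>) borel (\<lambda>\<omega>. u (fst \<omega>) + snd \<omega>) =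
    density lborel (batch_mixture n m (\<lambda>B. gauss_density \<sigma> (u B)))"
proof (rule measure_eqI)
  let ?p = "\<lambda>B. gauss_density \<sigma> (u B)"
  let ?X = "\<lambda>\<omega>. u (fst \<omega>) + snd \<omega>"
  interpret prob_space "gaussian_vec \<sigma> :: (real ^ 'p) measure"
    by (rule prob_space_gaussian_vec[OF \<sigma>_pos])
  fix A assume "A \<in> sets (distr (batch_noise n m \<sigma>) borel ?X)"
  then have A_sets [measurable]: "A \<in> sets borel" by simp
  have shift: "(\<integral>\<^sup>+ g. indicator A (u B + g) \<partial>gaussian_vec \<sigma>) =
      (\<integral>\<^sup>+ g. ennreal (?p B g) * indicator A g \<partial>lborel)" for B
  proof -
    have "(\<integral>\<^sup>+ g. indicator A (u B + g) \<partial>gaussian_vec \<sigma>) =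
        (\<integral>\<^sup>+ g. indicator A g \<partial>distr (gaussian_vec \<sigma>) borel ((+) (u B)))"
      by (rule nn_integral_distr[symmetric]) measurable
    then show ?thesis by (simp add: distr_gaussian_vec_plus emeasure_density)
  qed
  have "emeasure (distr (batch_noise n m \<sigma>) borel ?X) A =
      (\<integral>\<^sup>+ \<omega>. indicator A (?X \<omega>) \<partial>batch_noise n m \<sigma>)"
    using u_noise by (simp add: nn_integral_distr flip: nn_integral_indicator)
  also have "\<dots> = (\<integral>\<^sup>+ B. \<integral>\<^sup>+ g. indicator A (u B + g) \<partial>gaussian_vec \<sigma> \<partial>pmf_of_set (batches n m))"
    using measurable_compose[OF u_noise borel_measurable_indicator[OF A_sets]]
    unfolding batch_noise_def by (subst nn_integral_fst[symmetric]) auto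
  also have "\<dots> = (\<Sum>B\<in>batches n m. \<integral>\<^sup>+ g. ennreal (?p B g) * indicator A g \<partial>lborel) *
      ennreal (1 / real (card (batches n m)))"
    using batches_nonempty[OF m_le] card_batches_pos[OF m_le] unfolding shift
    by (simp add: nn_integral_pmf_of_set divide_ennreal_def inverse_ennreal divide_inverse
        ennreal_of_nat_eq_real_of_nat)
  also have "\<dots> = (\<integral>\<^sup>+ g. ennreal (batch_mixture n m ?p g) * indicator A g \<partial>lborel)"
    using \<sigma>_pos
    by (intro nn_integral_batch_mixture_mult[symmetric]) (auto simp: gauss_density_pos less_imp_le)
  also have "\<dots> = emeasure (density lborel (batch_mixture n m ?p)) A"
    by (rule emeasure_density[symmetric]) measurable
  finally show "emeasure (distr (batch_noise n m \<sigma>) borel ?X) A = \<dots>" .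
qed simp

lemma borel_measurable_noisy_batch_gradient:
  assumes cont: "\<And>d. continuous_on UNIV (\<lambda>x. grad x d)"
    and f_measurable [measurable]: "f \<in> measurable M (batch_noise n m \<sigma>)"
    and g_measurable: "g \<in> borel_measurable M"
  shows "(\<lambda>x. batch_gradient grad m D (g x) (fst (f x)) + snd (f x)) \<in> borel_measurable M"
proof -
  have [measurable]: "f \<in> measurable M (count_space UNIV \<Otimes>\<^sub>M borel)"
    using f_measurable measurable_cong_sets[OF refl sets_batch_noise] by blast
  show ?thesis
    by (intro borel_measurable_add borel_measurable_batch_gradient cont g_measurable) measurable
qed

definition noisy_gradient_law ::
    "(real ^ 'p \<Rightarrow> 'd \<Rightarrow> real ^ 'p) \<Rightarrow> nat \<Rightarrow> nat \<Rightarrow> real \<Rightarrow> 'd list \<Rightarrow> real ^ 'p \<Rightarrow>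
     (real ^ 'p) measure" where
  "noisy_gradient_law grad n m \<sigma> D x =
    distr (batch_noise n m \<sigma>) borel (\<lambda>\<omega>. batch_gradient grad m D x (fst \<omega>) + snd \<omega>)"

lemma renyi_moment_le_noisy_gradient_law:
  fixes grad :: "real ^ 'p \<Rightarrow> 'd \<Rightarrow> real ^ 'p"
  assumes cont: "\<And>d. continuous_on UNIV (\<lambda>x. grad x d)"
    and bound: "\<And>x d. norm (grad x d) \<le> C"
    and \<sigma>_pos: "\<sigma> > 0" and batch_size: "1 \<le> m" "m \<le> n"
    and \<alpha>_ge_2: "\<alpha> \<ge> 2" and neighbors: "neighboring n D D'"
  shows "renyi_moment_le \<alpha> (noisy_gradient_law grad n m \<sigma> D x) (noisy_gradient_law grad n m \<sigma> D' x)
    (subsampled_gauss_bound (real m / real n) \<sigma> (2 * C / real m) \<alpha>)"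
proof -
  obtain i where i_less: "i < n" and agree: "\<And>j. j < n \<Longrightarrow> j \<noteq> i \<Longrightarrow> D ! j = D' ! j"
    using neighbors by (auto simp: neighboring_def)
  define p where "p E B = gauss_density \<sigma> (batch_gradient grad m E x B)" for E B
  have p_pos: "p E B g > 0" for E B g using \<sigma>_pos by (simp add: p_def gauss_density_pos)
  have [measurable]: "p E B \<in> borel_measurable lborel" for E B by (simp add: p_def)
  have density: "noisy_gradient_law grad n m \<sigma> E x = density lborel (batch_mixture n m (p E))" for E
    unfolding noisy_gradient_law_def p_def
    by (intro distr_batch_noise_plus \<sigma>_pos batch_size
        borel_measurable_noisy_batch_gradient[OF cont measurable_ident_sets[OF refl]]) simp
  have agree_batch: "D ! j = D' ! j" if "B \<in> batches n m" "j \<in> B" "j \<noteq> i" for B j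
    using that by (intro agree) (auto simp: batches_def)
  have "power_divergence lborel \<alpha> (batch_mixture n m (p D)) (batch_mixture n m (p D')) \<le>
      ennreal (subsampled_gauss_bound (real m / real n) \<sigma> (2 * C / real m) \<alpha>)"
    unfolding p_def
  proof (rule power_divergence_subsampled_gauss_le[OF \<sigma>_pos batch_size i_less \<alpha>_ge_2])
    fix B assume B_batch: "B \<in> batches n m"
    show "batch_gradient grad m D x B = batch_gradient grad m D' x B" if "i \<notin> B"
      using agree_batch[OF B_batch] that
      by (auto simp: batch_gradient_def intro!: sum.cong arg_cong[where f = "grad x"])
    fix l assume "i \<in> B"
    then show "norm (batch_gradient grad m D x B - batch_gradient grad m D' x (swap_index i B l))
        \<le> 2 * C / real m"
      and "norm (batch_gradient grad m D' x B - batch_gradient grad m D' x (swap_index i B l))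
        \<le> 2 * C / real m"
      using B_batch by (auto intro!: norm_batch_gradient_swap_index_le bound agree_batch batches_finite)
  qed
  then show ?thesis
    unfolding density using p_pos batch_size \<alpha>_ge_2
    by (intro renyi_moment_le_density) (auto intro!: batch_mixture_pos less_imp_le)
qed

definition ssadmm_noise_step ::
    "(real ^ 'p \<Rightarrow> 'd \<Rightarrow> real ^ 'p) \<Rightarrow> nat \<Rightarrow> real \<Rightarrow> real \<Rightarrow> (nat \<Rightarrow> real) \<Rightarrow> 'd list \<Rightarrow>
     nat \<Rightarrow> nat set \<times> (real ^ 'p) \<Rightarrow> 'p admm_state \<Rightarrow> 'p admm_state" where
  "ssadmm_noise_step grad m lam \<rho> \<eta> D t \<omega> s = ssadmm_step D grad m lam \<rho> (\<eta> t) (fst \<omega>) (snd \<omega>) s"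

lemma ssadmm_iter_eq_noisy_iterate:
  "ssadmm_iter D grad m lam \<rho> \<eta> s \<omega> t = noisy_iterate (ssadmm_noise_step grad m lam \<rho> \<eta> D) s \<omega> t"
  by (induction t) (simp_all add: ssadmm_noise_step_def)

context
  fixes grad :: "real ^ 'p \<Rightarrow> 'd \<Rightarrow> real ^ 'p" and lam \<rho> \<sigma> :: real
    and n m :: nat and \<eta> :: "nat \<Rightarrow> real"
  assumes cont: "\<And>d. continuous_on UNIV (\<lambda>x. grad x d)"
    and lam_nonneg: "lam \<ge> 0" and \<rho>_nonneg: "\<rho> \<ge> 0" and \<sigma>_pos: "\<sigma> > 0"
begin

private abbreviation "noise \<equiv> batch_noise n m \<sigma> :: (nat set \<times> (real ^ 'p)) measure"
private abbreviation "step \<equiv> ssadmm_noise_step grad m lam \<rho> \<eta>"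
private abbreviation "trajectory_law \<equiv> \<lambda>D s. noisy_iterate_law noise borel (step D) s"

lemma borel_measurable_ssadmm_noise_step:
  "(\<lambda>(\<omega>, s). step D t \<omega> s) \<in> measurable (noise \<Otimes>\<^sub>M borel) borel"
proof -
  note borel_measurable_fst [measurable]
  show ?thesis
    unfolding ssadmm_noise_step_def ssadmm_step_eq_admm_update case_prod_unfold
    by (intro borel_measurable_admm_update borel_measurable_noisy_batch_gradient cont
        lam_nonneg \<rho>_nonneg) measurable
qed

lemma renyi_moment_le_ssadmm_noise_step:
  assumes bound: "\<And>x d. norm (grad x d) \<le> C" and batch_size: "1 \<le> m" "m \<le> n"
    and neighbors: "neighboring n D D'" and \<alpha>_ge_2: "\<alpha> \<ge> 2"
  shows "renyi_moment_le \<alpha>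
    (distr noise borel (\<lambda>\<omega>. step D t \<omega> s)) (distr noise borel (\<lambda>\<omega>. step D' t \<omega> s))
    (subsampled_gauss_bound (real m / real n) \<sigma> (2 * C / real m) \<alpha>)"
proof -
  have update: "admm_update lam \<rho> (\<eta> t) s \<in> borel_measurable borel"
    by (rule borel_measurable_admm_update[OF lam_nonneg \<rho>_nonneg]) measurable
  have gradient: "(\<lambda>\<omega>. batch_gradient grad m E (fst s) (fst \<omega>) + snd \<omega>) \<in> borel_measurable noise"
    for E
    by (intro borel_measurable_noisy_batch_gradient[OF cont measurable_ident_sets[OF refl]]) simp
  have step_law: "distr noise borel (\<lambda>\<omega>. step E t \<omega> s) =
      distr (noisy_gradient_law grad n m \<sigma> E (fst s)) borel (admm_update lam \<rho> (\<eta> t) s)" for E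
    by (simp add: noisy_gradient_law_def distr_distr[OF update gradient] comp_def
        ssadmm_noise_step_def ssadmm_step_eq_admm_update)
  show ?thesis
    unfolding step_law
    by (intro renyi_moment_le_distr renyi_moment_le_noisy_gradient_law cont bound \<sigma>_pos batch_size
        neighbors \<alpha>_ge_2)
       (simp add: noisy_gradient_law_def update)
qed

lemma ssadmm_eq_distr_noisy_iterate_law:
  "ssadmm grad n m lam \<rho> T \<eta> \<sigma> x0 z0 y0 D = distr (trajectory_law D (x0, z0, y0) T) borel fst"
proof -
  have "(\<lambda>\<omega>. noisy_iterate (step D) (x0, z0, y0) \<omega> T) \<in> borel_measurable (\<Pi>\<^sub>M i\<in>{..<T}. noise)"
    by (intro measurable_noisy_iterate borel_measurable_ssadmm_noise_step) auto
  from distr_distr[OF borel_measurable_fst this] show ?thesis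
    by (simp add: ssadmm_def noisy_iterate_law_def batch_noise_def ssadmm_iter_eq_noisy_iterate
        comp_def)
qed

lemma prob_space_ssadmm:
  "prob_space (ssadmm grad n m lam \<rho> T \<eta> \<sigma> x0 z0 y0 D)"
  unfolding ssadmm_eq_distr_noisy_iterate_law
  by (intro prob_space.prob_space_distr prob_space_noisy_iterate_law prob_space_batch_noise \<sigma>_pos
      borel_measurable_ssadmm_noise_step)
     (auto simp: borel_measurable_fst)

lemma renyi_moment_le_ssadmm:
  assumes bound: "\<And>x d. norm (grad x d) \<le> C" and batch_size: "1 \<le> m" "m \<le> n"
    and neighbors: "neighboring n D D'" and \<alpha>_ge_2: "\<alpha> \<ge> 2"
  shows "renyi_moment_le \<alpha>
    (ssadmm grad n m lam \<rho> T \<eta> \<sigma> x0 z0 y0 D) (ssadmm grad n m lam \<rho> T \<eta> \<sigma> x0 z0 y0 D')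
    (subsampled_gauss_bound (real m / real n) \<sigma> (2 * C / real m) \<alpha> ^ T)"
proof -
  have "subsampled_gauss_bound (real m / real n) \<sigma> (2 * C / real m) \<alpha> > 0"
    by (rule less_le_trans[OF _ subsampled_gauss_bound_ge_1]) auto
  then have "renyi_moment_le \<alpha> (trajectory_law D (x0, z0, y0) T) (trajectory_law D' (x0, z0, y0) T)
      (\<Prod>t<T. subsampled_gauss_bound (real m / real n) \<sigma> (2 * C / real m) \<alpha>)"
    by (intro renyi_moment_le_noisy_iterate_law prob_space_batch_noise
        borel_measurable_ssadmm_noise_step
        renyi_moment_le_ssadmm_noise_step bound batch_size neighbors \<sigma>_pos \<alpha>_ge_2) auto
  then show ?thesis
    unfolding ssadmm_eq_distr_noisy_iterate_law
    by (intro renyi_moment_le_distr)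
       (auto simp: borel_measurable_fst)
qed

end

theorem theorem1:
  fixes f :: "real ^ 'p \<Rightarrow> 'd \<Rightarrow> real"
    and grad :: "real ^ 'p \<Rightarrow> 'd \<Rightarrow> real ^ 'p"
    and C lam \<rho> \<sigma> :: real
    and n m T :: nat
    and \<eta> :: "nat \<Rightarrow> real"
    and x0 z0 y0 :: "real ^ 'p"
    and \<alpha> :: nat
  assumes grad: "\<And>x d. GDERIV (\<lambda>u. f u d) x :> grad x d"
    and cont: "\<And>d. continuous_on UNIV (\<lambda>x. grad x d)"
    and convex: "\<And>d. convex_on UNIV (\<lambda>x. f x d)"
    and bound: "\<And>x d. norm (grad x d) \<le> C"
    and C_pos: "C > 0"
    and lam_pos: "lam > 0" and rho_pos: "\<rho> > 0"
    and m_ge: "1 \<le> m" and m_le: "m \<le> n"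
    and eta_pos: "\<And>k. k < T \<Longrightarrow> \<eta> k > 0"
    and sigma_pos: "\<sigma> > 0"
    and alpha_ge: "\<alpha> \<ge> 2"
  shows "renyi_dp n (ssadmm grad n m lam \<rho> T \<eta> \<sigma> x0 z0 y0) (real \<alpha>)
           (real T * eps_prime C n m \<sigma> \<alpha>)"
  unfolding renyi_dp_def
proof (intro allI impI)
  fix D D' :: "'d list" assume neighbors: "neighboring n D D'"
  let ?A = "ssadmm grad n m lam \<rho> T \<eta> \<sigma> x0 z0 y0"
  define K where "K = subsampled_gauss_bound (real m / real n) \<sigma> (2 * C / real m) \<alpha>"
  have K_ge_1: "K \<ge> 1" unfolding K_def by (rule subsampled_gauss_bound_ge_1) simp
  have "renyi_moment_le \<alpha> (?A D) (?A D') (K ^ T)"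
    unfolding K_def
    using cont lam_pos rho_pos sigma_pos bound m_ge m_le neighbors alpha_ge
    by (intro renyi_moment_le_ssadmm) auto
  moreover have "prob_space (?A D')"
    using cont lam_pos rho_pos sigma_pos by (intro prob_space_ssadmm) auto
  ultimately have "renyi_divergence (real \<alpha>) (?A D) (?A D') \<le> ereal (ln (K ^ T) / (real \<alpha> - 1))"
    using alpha_ge K_ge_1
    by (intro renyi_divergence_le_if_renyi_moment_le) (auto intro: one_le_power)
  also have "ln (K ^ T) / (real \<alpha> - 1) = real T * eps_prime C n m \<sigma> \<alpha>"
    using K_ge_1
    by (simp add: eps_prime_eq_ln_subsampled_gauss_bound[OF alpha_ge] ln_realpow flip: K_def)
  finally show "renyi_divergence (real \<alpha>) (?A D) (?A D') \<le> ereal (real T * eps_prime C n m \<sigma> \<alpha>)" .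
qed

end
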